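(* For $n\ge 1$, \[W_3(n)=\sum_{g=1}^{n+1}B^{(g)}_{\ge 0}(n),\] where the numbers $B^{(g)}_{\ge\ell}(n)$ satisfy: $B^{(0)}_{\ge\ell}(n)=0$; $B^{(g)}_{\ge\ell}(1)=C_{\ell+1}$ if $g=2$ and $B^{(g)}_{\ge\ell}(1)=0$ if $g\neq 2$; and for all $n,g\ge 1$ and $\ell\ge 0$, \[B^{(g)}_{\ge\ell}(n+1)=\sum_{j=1}^{\ell}\left(\sum_{a=2}^{n}\ \sum_{b=\max\{2,g-a\}}^{g-1}\ \sum_{i=a-1}^{n-b+1}B^{(a)}_{\ge j-1}(i)\,B^{(b)}_{\ge \ell-j+1}(n-i)+B^{(g-1)}_{\ge j-1}(n)\,C_{\ell-j+1}\right)+B^{(g-1)}_{\ge\ell+1}(n).\]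
   Context: $S_n$ is the set of permutations of $\{1,\dots,n\}$ in one-line notation. The stack-sorting map $s$: given an input permutation, repeatedly: if the stack is empty or the next input entry is smaller than the top of the stack, push the next input entry; otherwise pop the top of the stack to the end of the output. $s(\pi)$ is the final output. A permutation $\pi$ is $t$-stack-sortable if $s^t(\pi)$ is increasing; $\mathcal W_t(n)$ is the set of $t$-stack-sortable permutations in $S_n$ and $W_t(n)=|\mathcal W_t(n)|$. $C_m=\frac{1}{m+1}\binom{2m}{m}$ is the $m$th Catalan number. For $\pi=\pi_1\cdots\pi_N\in S_N$, the tail length $\operatorname{tl}(\pi)$ is the smallest nonnegative integer $\ell$ with $\pi_{N-\ell}\neq N-\ell$, with the convention $\operatorname{tl}(12\cdots N)=N$. For $a\in\{0,\dots,N\}$, the open interval $(a,a+1)$ is a legal space for $\pi$ if there do not exist indices $i_1<i_2<i_3$ with $\pi_{i_3}\le a<\pi_{i_1}<\pi_{i_2}$; $\operatorname{leg}(\pi)$ is the number of legal spaces of $\pi$. For integers $n\ge 1$, $\ell\ge 0$, $g\ge 0$, $B^{(g)}_{\ge\ell}(n)$ is the number of $\sigma\in\mathcal W_3(n+\ell)$ such that $\operatorname{tl}(s(\sigma))\ge\ell$ and $\operatorname{leg}(s(\sigma))=\ell+g$. *)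

theory Defs
  imports Complex_Main "HOL-Combinatorics.Multiset_Permutations"
begin

text \<open>
  A permutation of \<open>{1..n}\<close> in one-line notation is a list in \<open>permutations_of_set {1..n}\<close>.
  List positions start at 0, so the entry \<open>\<pi>\<^sub>i\<close> is \<open>\<pi> ! (i - 1)\<close>.
\<close>

text \<open>
  The arguments of \<open>stack_run\<close> are the remaining input and the stack, whose head is its top.
  The result is the output still to be produced.
\<close>

fun stack_run :: "nat list \<Rightarrow> nat list \<Rightarrow> nat list" where
  "stack_run [] [] = []"
| "stack_run [] (t # st) = t # stack_run [] st"
| "stack_run (x # xs) [] = stack_run xs [x]"
| "stack_run (x # xs) (t # st) =
     (if x < t then stack_run xs (x # t # st) else t # stack_run (x # xs) st)"

definition stack_sort :: "nat list \<Rightarrow> nat list" where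
  "stack_sort \<pi> = stack_run \<pi> []"

definition stack_sortable :: "nat \<Rightarrow> nat list \<Rightarrow> bool" where
  "stack_sortable t \<pi> \<longleftrightarrow> sorted_wrt (<) ((stack_sort ^^ t) \<pi>)"

definition sortable_perms :: "nat \<Rightarrow> nat \<Rightarrow> nat list set" where
  "sortable_perms t n = {\<pi> \<in> permutations_of_set {1..n}. stack_sortable t \<pi>}"

definition W :: "nat \<Rightarrow> nat \<Rightarrow> nat" where
  "W t n = card (sortable_perms t n)"

definition tail_length :: "nat list \<Rightarrow> nat" where
  "tail_length \<pi> =
     (if \<pi> = [1..<Suc (length \<pi>)] then length \<pi>
      else (LEAST l. l < length \<pi> \<and> \<pi> ! (length \<pi> - l - 1) \<noteq> length \<pi> - l))"

text \<open>\<open>legal_space \<pi> a\<close>: the open interval \<open>(a, a + 1)\<close> is a legal space for \<open>\<pi>\<close>.\<close>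

definition legal_space :: "nat list \<Rightarrow> nat \<Rightarrow> bool" where
  "legal_space \<pi> a \<longleftrightarrow>
     a \<le> length \<pi> \<and>
     \<not> (\<exists>i\<^sub>1 i\<^sub>2 i\<^sub>3. i\<^sub>1 < i\<^sub>2 \<and> i\<^sub>2 < i\<^sub>3 \<and> i\<^sub>3 < length \<pi> \<and>
          \<pi> ! i\<^sub>3 \<le> a \<and> a < \<pi> ! i\<^sub>1 \<and> \<pi> ! i\<^sub>1 < \<pi> ! i\<^sub>2)"

definition leg :: "nat list \<Rightarrow> nat" where
  "leg \<pi> = card {a. legal_space \<pi> a}"

text \<open>\<open>B g l n\<close> stands for \<open>B\<close> with superscript \<open>(g)\<close>, subscript \<open>\<ge> l\<close> and argument \<open>n\<close>.\<close>

definition B :: "nat \<Rightarrow> nat \<Rightarrow> nat \<Rightarrow> nat" where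
  "B g l n = card {\<sigma> \<in> sortable_perms 3 (n + l).
     tail_length (stack_sort \<sigma>) \<ge> l \<and> leg (stack_sort \<sigma>) = l + g}"

definition catalan :: "nat \<Rightarrow> nat" where
  "catalan m = ((2 * m) choose m) div (m + 1)"

text \<open>The division in \<open>catalan\<close> is exact.\<close>

lemma of_nat_catalan: "real (catalan m) = real ((2 * m) choose m) / real (m + 1)"
proof -
  have "Suc m * ((2 * m) choose Suc m) = m * ((2 * m) choose m)"
    using binomial_absorb_comp[of "2 * m" m] binomial_absorption[of m "2 * m"]
    by (simp add: mult_2)
  hence "(2 * m) choose m = (m + 1) * (((2 * m) choose m) - ((2 * m) choose Suc m))"
    by (simp add: diff_mult_distrib2)
  hence "(m + 1) dvd ((2 * m) choose m)"
    by (rule dvdI)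
  thus ?thesis
    unfolding catalan_def by (rule real_of_nat_div)
qed

end

theory Submission
  imports Defs
begin

text \<open>
  Write \<open>s\<close> for the stack-sorting map, so that \<open>s (L m R) = s L s R m\<close> for the maximum \<open>m\<close>. A space
  \<open>(a, a + 1)\<close> is legal for \<open>\<pi>\<close> iff all entries \<open>\<le> a\<close> precede all entries \<open>> a\<close> in \<open>s \<pi>\<close>, and \<open>\<pi>\<close> is
  2-stack-sortable iff \<open>s \<pi>\<close> avoids 231. Since the maximum of \<open>L\<close> ends \<open>s L\<close>, the word \<open>s L s R m\<close>
  avoids 231 iff \<open>s L\<close> and \<open>s R\<close> do, all entries of \<open>L\<close> but its maximum lie below \<open>R\<close>, and this
  maximum lies in a legal space of \<open>R\<close>.

  \<open>B g l n\<close> sums, over the 2-stack-sortable \<open>\<pi>\<close> of length \<open>n\<close> with \<open>g\<close> legal spaces, the number of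
  preimages of \<open>\<pi>\<close> followed by an increasing tail of length \<open>l\<close>. Write a permutation of length
  \<open>n + 1\<close> as \<open>L m R\<close>. If \<open>R\<close> is empty, then \<open>m\<close> joins the tail. Otherwise a preimage of \<open>L m R\<close> with
  its tail splits into a preimage of \<open>R\<close> with the first \<open>j - 1\<close> tail entries and one of \<open>L m\<close> with the
  last \<open>l - j\<close>, and the choice of the legal space of \<open>R\<close> that contains the maximum of \<open>L\<close> is
  determined by the number of legal spaces of \<open>L m R\<close>.
\<close>

section \<open>The stack-sorting map\<close>

lemma ex_max_split:
  fixes w :: "'a :: linorder list"
  assumes "distinct w" "w \<noteq> []"
  shows "\<exists>L m R. w = L @ m # R \<and> (\<forall>x\<in>set L \<union> set R. x < m)"
proof -
  have "Max (set w) \<in> set w" using assms(2) by simp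
  then obtain L R where w: "w = L @ Max (set w) # R" by (meson split_list)
  have "x < Max (set w)" if "x \<in> set L \<union> set R" for x
  proof -
    have "x \<in> set w" by (subst w) (use that in auto)
    moreover have "Max (set w) \<notin> set L \<union> set R"
      using assms(1) by (subst (asm) w) (auto simp del: Max_less_iff)
    ultimately show ?thesis using that by (metis List.finite_set Max_ge order.not_eq_order_implies_strict)
  qed
  then show ?thesis using w by blast
qed

text \<open>Induction along the decreasing binary tree of a word, the recursion that
  \<open>stack_sort\<close> follows by \<open>stack_sort_split\<close>.\<close>

lemma max_split_induct [consumes 1, case_names Nil split]:
  fixes w :: "'a :: linorder list"
  assumes "distinct w"
    and "P []"
    and "\<And>L m R. distinct (L @ m # R) \<Longrightarrow> \<forall>x\<in>set L \<union> set R. x < m \<Longrightarrow> P L \<Longrightarrow> P R \<Longrightarrow> P (L @ m # R)"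
  shows "P w"
  using assms(1)
proof (induction w rule: length_induct)
  case (1 w)
  show ?case
  proof (cases "w = []")
    case False
    then obtain L m R where w: "w = L @ m # R" "\<forall>x\<in>set L \<union> set R. x < m"
      using ex_max_split 1(2) by blast
    then have "P L" "P R" using 1 by auto
    then show ?thesis using assms(3)[of L m R] 1(2) w by simp
  qed (use assms(2) in simp)
qed

lemma mset_stack_run: "mset (stack_run xs st) = mset xs + mset st"
  by (induction xs st rule: stack_run.induct) auto

lemma mset_stack_sort [simp]: "mset (stack_sort w) = mset w"
  by (simp add: stack_sort_def mset_stack_run)

lemma set_stack_sort [simp]: "set (stack_sort w) = set w"
  by (metis mset_stack_sort set_mset_mset)

lemma length_stack_sort [simp]: "length (stack_sort w) = length w"
  by (metis mset_stack_sort size_mset)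

lemma distinct_stack_sort [simp]: "distinct (stack_sort w) = distinct w"
  by (metis mset_stack_sort mset_eq_imp_distinct_iff)

text \<open>Every input entry is pushed above \<open>m\<close>, so \<open>m\<close> leaves the stack
  only after the input is exhausted.\<close>

lemma stack_run_bottom:
  "\<forall>x\<in>set xs. x < m \<Longrightarrow> stack_run xs (st @ [m]) = stack_run xs st @ [m]"
  by (induction xs st rule: stack_run.induct) auto

text \<open>On its arrival \<open>m\<close> exceeds everything on the stack, so the stack is emptied
  before \<open>m\<close> is pushed.\<close>

lemma stack_run_max:
  "\<forall>x\<in>set xs \<union> set st. x < m \<Longrightarrow>
     stack_run (xs @ m # ys) st = stack_run xs st @ stack_run ys [m]"
  by (induction xs st rule: stack_run.induct) auto

lemma stack_sort_Nil [simp]: "stack_sort [] = []"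
  by (simp add: stack_sort_def)

lemma stack_sort_split:
  assumes "\<forall>x\<in>set L \<union> set R. x < m"
  shows "stack_sort (L @ m # R) = stack_sort L @ stack_sort R @ [m]"
  using stack_run_max[of L "[]" m R] stack_run_bottom[of R m "[]"] assms
  by (simp add: stack_sort_def)

lemma stack_sort_snoc:
  "\<forall>x\<in>set L. x < m \<Longrightarrow> stack_sort (L @ [m]) = stack_sort L @ [m]"
  using stack_sort_split[of L "[]" m] by simp

lemma stack_sort_map:
  assumes "strict_mono f" "distinct w"
  shows "stack_sort (map f w) = map f (stack_sort w)"
  using assms(2)
proof (induction w rule: max_split_induct)
  case (split L m R)
  have "\<forall>x\<in>set (map f L) \<union> set (map f R). x < f m"
    using split(2) assms(1) by (auto simp: strict_mono_less)
  then show ?case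
    using split(2-4) stack_sort_split[of "map f L" "map f R" "f m"] stack_sort_split[of L R m]
    by simp
qed simp

text \<open>Equivalently, the entries at most \<open>a\<close> form a prefix. Applied to
  \<open>stack_sort w\<close>, this will describe the legal spaces of \<open>w\<close>.\<close>

abbreviation splits :: "nat \<Rightarrow> nat list \<Rightarrow> bool" where
  "splits a \<equiv> sorted_wrt (\<lambda>y z. z \<le> a \<longrightarrow> y \<le> a)"

text \<open>The head \<open>x\<close> plays the 2: \<open>splits x w\<close> fails when a larger
  entry precedes a smaller one. For words with distinct entries this is avoidance of the pattern; a
  later copy of \<open>x\<close> would also count as a 1.\<close>

fun avoids_231 :: "nat list \<Rightarrow> bool" where
  "avoids_231 [] = True"
| "avoids_231 (x # w) = (splits x w \<and> avoids_231 w)"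

text \<open>The last two conjuncts exclude the patterns that straddle the cut, with 31 in
  \<open>v\<close> and with 23 in \<open>u\<close>.\<close>

lemma avoids_231_append:
  assumes "distinct (u @ v)"
  shows "avoids_231 (u @ v) \<longleftrightarrow> avoids_231 u \<and> avoids_231 v \<and> (\<forall>x\<in>set u. splits x v) \<and>
    (\<forall>z\<in>set v. sorted_wrt (\<lambda>x y. z < x \<longrightarrow> y \<le> x) u)"
  using assms by (induction u) (force simp: sorted_wrt_append)+

lemma splits_trivial: "\<forall>y\<in>set w. y \<le> a \<Longrightarrow> splits a w" "\<forall>y\<in>set w. a < y \<Longrightarrow> splits a w"
  by (induction w) auto

lemma avoids_231_snoc:
  assumes "\<forall>x\<in>set w. x < m" "distinct w"
  shows "avoids_231 (w @ [m]) = avoids_231 w"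
proof -
  have "sorted_wrt (\<lambda>x y. m < x \<longrightarrow> y \<le> x) w"
    using assms(1) by (induction w) auto
  then show ?thesis using assms by (subst avoids_231_append) auto
qed

text \<open>Knuth's criterion. The maximum is a 3 between \<open>L\<close> and \<open>R\<close>, so
  avoidance forces \<open>L\<close> below \<open>R\<close>, which is what an increasing output
  requires.\<close>

lemma sorted_stack_sort_iff:
  assumes "distinct w"
  shows "sorted_wrt (<) (stack_sort w) \<longleftrightarrow> avoids_231 w"
  using assms
proof (induction w rule: max_split_induct)
  case (split L m R)
  have r: "sorted_wrt (<) (stack_sort (L @ m # R)) \<longleftrightarrow>
    avoids_231 L \<and> avoids_231 R \<and> (\<forall>x\<in>set L. \<forall>z\<in>set R. x < z)"
    using split by (auto simp: stack_sort_split sorted_wrt_append)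
  have "avoids_231 (L @ m # R) \<longleftrightarrow> avoids_231 L \<and> avoids_231 R \<and>
    (\<forall>x\<in>set L. splits x (m # R)) \<and>
    (\<forall>z\<in>set (m # R). sorted_wrt (\<lambda>x y. z < x \<longrightarrow> y \<le> x) L)"
    using splits_trivial(1)[of R m] split(2) less_imp_le
    by (subst avoids_231_append[OF split(1)]) (simp only: avoids_231.simps, blast)
  moreover have "(\<forall>x\<in>set L. splits x (m # R)) \<longleftrightarrow> (\<forall>x\<in>set L. \<forall>z\<in>set R. x < z)"
  proof
    assume "\<forall>x\<in>set L. splits x (m # R)"
    then have "\<forall>x\<in>set L. \<forall>z\<in>set R. z \<le> x \<longrightarrow> m \<le> x" by simp
    then show "\<forall>x\<in>set L. \<forall>z\<in>set R. x < z" using split(2) by (meson UnI1 leD not_le)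
  next
    assume "\<forall>x\<in>set L. \<forall>z\<in>set R. x < z"
    then show "\<forall>x\<in>set L. splits x (m # R)"
      using split(2) splits_trivial(2)[of "m # R"] by (metis UnI1 set_ConsD)
  qed
  moreover have "\<forall>z\<in>set (m # R). sorted_wrt (\<lambda>x y. z < x \<longrightarrow> y \<le> x) L"
    if "\<forall>x\<in>set L. \<forall>z\<in>set (m # R). x < z"
    using that by (induction L) auto
  ultimately show ?case using r split(2) by auto
qed simp

lemma sortable_3_iff:
  assumes "distinct w"
  shows "stack_sortable 3 w \<longleftrightarrow> avoids_231 (stack_sort (stack_sort w))"
  using sorted_stack_sort_iff[of "stack_sort (stack_sort w)"] assms
  by (simp add: stack_sortable_def numeral_3_eq_3)

section \<open>Legal spaces\<close>

text \<open>Recursive form of the condition in \<open>legal_space\<close>: \<open>x\<close>,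
  \<open>y\<close> and \<open>z\<close> are the first, second and third entry of the forbidden
  pattern.\<close>

fun no_pattern :: "nat \<Rightarrow> nat list \<Rightarrow> bool" where
  "no_pattern a [] = True"
| "no_pattern a (x # w) = (no_pattern a w \<and> (a < x \<longrightarrow> sorted_wrt (\<lambda>y z. z \<le> a \<longrightarrow> y \<le> x) w))"

lemma no_pattern_iff:
  "no_pattern a w \<longleftrightarrow> \<not> (\<exists>i j k. i < j \<and> j < k \<and> k < length w \<and>
     w ! k \<le> a \<and> a < w ! i \<and> w ! i < w ! j)" (is "_ \<longleftrightarrow> \<not> ?P w")
proof (induction w)
  case (Cons x w)
  have "?P (x # w) \<longleftrightarrow> ?P w \<or> (\<exists>j k. j < k \<and> k < length w \<and> w ! k \<le> a \<and> a < x \<and> x < w ! j)"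
    (is "_ \<longleftrightarrow> _ \<or> ?Q")
  proof
    assume "?P (x # w)"
    then obtain i j k where *: "i < j" "j < k" "k < length (x # w)"
      "(x # w) ! k \<le> a" "a < (x # w) ! i" "(x # w) ! i < (x # w) ! j" by blast
    obtain j' k' where "j = Suc j'" "k = Suc k'" using * by (metis less_nat_zero_code not0_implies_Suc)
    then show "?P w \<or> ?Q" using * by (cases i) auto
  next
    assume "?P w \<or> ?Q"
    then show "?P (x # w)"
    proof
      assume "?P w"
      then obtain i j k where "i < j" "j < k" "k < length w" "w ! k \<le> a" "a < w ! i" "w ! i < w ! j"
        by blast
      then show ?thesis by (intro exI[of _ "Suc i"] exI[of _ "Suc j"] exI[of _ "Suc k"]) auto
    next
      assume ?Q
      then obtain j k where "j < k" "k < length w" "w ! k \<le> a" "a < x" "x < w ! j" by blast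
      then show ?thesis by (intro exI[of _ 0] exI[of _ "Suc j"] exI[of _ "Suc k"]) auto
    qed
  qed
  moreover have "(a < x \<longrightarrow> sorted_wrt (\<lambda>y z. z \<le> a \<longrightarrow> y \<le> x) w) \<longleftrightarrow> \<not> ?Q"
    unfolding sorted_wrt_iff_nth_less not_less[symmetric] by blast
  ultimately show ?case using Cons.IH by simp
qed simp

lemma no_pattern_append:
  "no_pattern a (u @ v) \<longleftrightarrow> no_pattern a u \<and> no_pattern a v \<and>
     (\<forall>x\<in>set u. a < x \<longrightarrow> sorted_wrt (\<lambda>y z. z \<le> a \<longrightarrow> y \<le> x) v) \<and>
     (\<forall>z\<in>set v. z \<le> a \<longrightarrow> sorted_wrt (\<lambda>x y. a < x \<longrightarrow> y \<le> x) u)"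
  by (induction u) (auto simp: sorted_wrt_append)

text \<open>The maximum \<open>m\<close> ends the output and never violates the prefix condition;
  beyond \<open>L\<close> and \<open>R\<close> themselves only pairs across them matter.\<close>

lemma splits_stack_sort_split:
  assumes "\<forall>x\<in>set L \<union> set R. x < m"
  shows "splits a (stack_sort (L @ m # R)) \<longleftrightarrow>
    splits a (stack_sort L) \<and> splits a (stack_sort R) \<and> (\<forall>x\<in>set L. \<forall>z\<in>set R. z \<le> a \<longrightarrow> x \<le> a)"
proof -
  have "splits a (stack_sort L @ stack_sort R @ [m]) \<longleftrightarrow>
    splits a (stack_sort L) \<and> splits a (stack_sort R) \<and> (\<forall>x\<in>set L. \<forall>z\<in>set R. z \<le> a \<longrightarrow> x \<le> a) \<and>
    (\<forall>x\<in>set L. m \<le> a \<longrightarrow> x \<le> a) \<and> (\<forall>x\<in>set R. m \<le> a \<longrightarrow> x \<le> a)"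
    unfolding sorted_wrt_append set_stack_sort by (simp add: ball_Un ball_conj_distrib) argo
  moreover have "\<forall>x\<in>set L. m \<le> a \<longrightarrow> x \<le> a" "\<forall>x\<in>set R. m \<le> a \<longrightarrow> x \<le> a"
    using assms by (meson UnI1 UnI2 less_imp_le order_trans)+
  ultimately show ?thesis unfolding stack_sort_split[OF assms] by argo
qed

text \<open>An inversion \<open>(b, c)\<close> of \<open>stack_sort w\<close> comes from a pattern 231 of \<open>w\<close> with \<open>b\<close> as its 2
  and \<open>c\<close> as its 1.\<close>

lemma splits_stack_sort_iff:
  assumes "distinct w"
  shows "splits a (stack_sort w) \<longleftrightarrow> no_pattern a w"
  using assms
proof (induction w rule: max_split_induct)
  case (split L m R)
  have l: "splits a (stack_sort (L @ m # R)) \<longleftrightarrow>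
    no_pattern a L \<and> no_pattern a R \<and> (\<forall>x\<in>set L. \<forall>z\<in>set R. z \<le> a \<longrightarrow> x \<le> a)"
    unfolding splits_stack_sort_split[OF split(2)] using split(3,4) by simp
  have 1: "a < m \<longrightarrow> sorted_wrt (\<lambda>y z. z \<le> a \<longrightarrow> y \<le> m) R"
    using split(2) by (intro impI, induction R) (auto intro: less_imp_le)
  \<comment> \<open>With \<open>x > a\<close> from \<open>L\<close> as first entry and
    \<open>m\<close> as second, any \<open>z \<le> a\<close> in \<open>R\<close> completes a
    pattern.\<close>
  have 2: "(\<forall>x\<in>set L. a < x \<longrightarrow> sorted_wrt (\<lambda>y z. z \<le> a \<longrightarrow> y \<le> x) (m # R)) \<longleftrightarrow>
    (\<forall>x\<in>set L. a < x \<longrightarrow> (\<forall>z\<in>set R. a < z))" (is "?A \<longleftrightarrow> ?B")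
  proof
    assume ?A
    then have "\<forall>x\<in>set L. a < x \<longrightarrow> (\<forall>z\<in>set R. z \<le> a \<longrightarrow> m \<le> x)" by simp
    then show ?B using split(2) by (meson UnI1 leD not_le)
  next
    assume B: ?B
    show ?A
    proof (intro ballI impI)
      fix x assume x: "x \<in> set L" "a < x"
      then have "\<forall>z\<in>set R. a < z" using B by blast
      then have "sorted_wrt (\<lambda>y z. z \<le> a \<longrightarrow> y \<le> x) R" by (induction R) auto
      then show "sorted_wrt (\<lambda>y z. z \<le> a \<longrightarrow> y \<le> x) (m # R)"
        using \<open>\<forall>z\<in>set R. a < z\<close> by auto
    qed
  qed
  \<comment> \<open>Patterns with two entries in \<open>L\<close>: if some later entry is at most
    \<open>a\<close>, the hypothesis leaves no entry of \<open>L\<close> above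
    \<open>a\<close>.\<close>
  have 3: "\<forall>z\<in>set (m # R). z \<le> a \<longrightarrow> sorted_wrt (\<lambda>x y. a < x \<longrightarrow> y \<le> x) L"
    if B: "\<forall>x\<in>set L. a < x \<longrightarrow> (\<forall>z\<in>set (m # R). a < z)"
  proof (intro ballI impI)
    fix z assume "z \<in> set (m # R)" "z \<le> a"
    then have "\<forall>x\<in>set L. x \<le> a" using B by (meson leD not_le)
    then show "sorted_wrt (\<lambda>x y. a < x \<longrightarrow> y \<le> x) L" by (induction L) auto
  qed
  have 4: "(\<forall>x\<in>set L. a < x \<longrightarrow> (\<forall>z\<in>set (m # R). a < z)) \<longleftrightarrow>
    (\<forall>x\<in>set L. a < x \<longrightarrow> (\<forall>z\<in>set R. a < z))"
    using split(2) by (simp only: list.set ball_simps) (meson UnI1 less_trans)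
  have "no_pattern a (L @ m # R) \<longleftrightarrow> no_pattern a L \<and> no_pattern a R \<and>
    (\<forall>x\<in>set L. a < x \<longrightarrow> (\<forall>z\<in>set R. a < z))"
    unfolding no_pattern_append no_pattern.simps using 1 2 3 4 by argo
  then show ?case using l by (meson not_le)
qed simp

lemma leg_eq:
  assumes "distinct w"
  shows "leg w = card {a. a \<le> length w \<and> splits a (stack_sort w)}"
proof -
  have "legal_space w a \<longleftrightarrow> a \<le> length w \<and> splits a (stack_sort w)" for a
    unfolding legal_space_def splits_stack_sort_iff[OF assms] no_pattern_iff by blast
  then show ?thesis by (simp add: leg_def)
qed

section \<open>Fertility\<close>

definition preimages :: "nat list \<Rightarrow> nat list set" where
  "preimages w = {\<sigma>. distinct \<sigma> \<and> stack_sort \<sigma> = w}"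

definition fert :: "nat list \<Rightarrow> nat" where
  "fert w = card (preimages w)"

lemma finite_preimages [simp]: "finite (preimages w)"
proof (rule finite_subset)
  show "preimages w \<subseteq> {\<sigma>. mset \<sigma> = mset w}"
    unfolding preimages_def by (auto intro: mset_stack_sort[symmetric])
  show "finite {\<sigma>. mset \<sigma> = mset w}"
    using finite_permutations_of_multiset by (simp add: permutations_of_multiset_def)
qed

lemma stack_sort_last:
  assumes "distinct \<sigma>" "stack_sort \<sigma> = w @ [N]"
  shows "\<exists>\<sigma>1 \<sigma>2. \<sigma> = \<sigma>1 @ N # \<sigma>2 \<and> w = stack_sort \<sigma>1 @ stack_sort \<sigma>2 \<and> (\<forall>x\<in>set w. x < N)"
proof -
  have "\<sigma> \<noteq> []" using assms(2) by auto
  then obtain L m R where *: "\<sigma> = L @ m # R" "\<forall>x\<in>set L \<union> set R. x < m"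
    using ex_max_split assms(1) by blast
  then have "w = stack_sort L @ stack_sort R" "N = m"
    using assms(2) stack_sort_split[OF *(2)] by simp_all
  then show ?thesis using * by (intro exI[of _ L] exI[of _ R]) simp
qed

lemma fert_Nil [simp]: "fert [] = 1"
proof -
  have "\<sigma> = []" if "stack_sort \<sigma> = []" for \<sigma>
    using length_stack_sort[of \<sigma>] that by simp
  then have "preimages [] = {[]}" by (auto simp: preimages_def)
  then show ?thesis by (simp add: fert_def)
qed

text \<open>Sorting distinct entries yields a word that ends with its strict maximum.\<close>

lemma fert_eq_0:
  assumes "x \<in> set w" "N \<le> x"
  shows "fert (w @ [N]) = 0"
proof -
  have "preimages (w @ [N]) = {}"
    using stack_sort_last[of _ w N] assms unfolding preimages_def by (auto dest: leD)
  then show ?thesis by (simp add: fert_def)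
qed

text \<open>A preimage has the form \<open>u @ N # v\<close>, where \<open>u\<close> and
  \<open>v\<close> are preimages of the two parts into which \<open>length u\<close> cuts
  \<open>w\<close>.\<close>

lemma fert_snoc:
  assumes "\<forall>x\<in>set w. x < N" "distinct w"
  shows "fert (w @ [N]) = (\<Sum>k\<le>length w. fert (take k w) * fert (drop k w))"
proof -
  define P where "P k = preimages (take k w) \<times> preimages (drop k w)" for k
  define f where "f = (\<lambda>(u, v). u @ N # v :: nat list)"
  have set_P: "set u \<subseteq> set w \<and> set v \<subseteq> set w \<and> length u = min (length w) k"
    if "(u, v) \<in> P k" for u v k
  proof -
    have "stack_sort u = take k w" "stack_sort v = drop k w"
      using that by (simp_all add: P_def preimages_def)
    then show ?thesis
      by (metis length_stack_sort length_take set_drop_subset set_stack_sort set_take_subset)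
  qed
  have "N \<notin> set w" using assms(1) by auto
  have eq: "preimages (w @ [N]) = (\<Union>k\<le>length w. f ` P k)"
  proof (intro equalityI subsetI)
    fix \<sigma> assume "\<sigma> \<in> preimages (w @ [N])"
    then have \<sigma>: "distinct \<sigma>" "stack_sort \<sigma> = w @ [N]" by (auto simp: preimages_def)
    then obtain s1 s2 where s: "\<sigma> = s1 @ N # s2" "w = stack_sort s1 @ stack_sort s2"
      using stack_sort_last by blast
    then have "(s1, s2) \<in> P (length s1)"
      using \<sigma>(1) by (auto simp: P_def preimages_def)
    moreover have "length s1 \<le> length w" using s by simp
    moreover have "\<sigma> = f (s1, s2)" using s by (simp add: f_def)
    ultimately show "\<sigma> \<in> (\<Union>k\<le>length w. f ` P k)" by blast
  next
    fix \<sigma> assume "\<sigma> \<in> (\<Union>k\<le>length w. f ` P k)"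
    then obtain k u v where k: "(u, v) \<in> P k" "\<sigma> = u @ N # v" by (auto simp: f_def)
    have "stack_sort u = take k w" "stack_sort v = drop k w" "distinct u" "distinct v"
      using k(1) by (auto simp: P_def preimages_def)
    moreover have "\<forall>x\<in>set u \<union> set v. x < N" using set_P[OF k(1)] assms(1) by blast
    moreover have "set u \<inter> set v = {}"
      using calculation(1,2) set_take_disj_set_drop_if_distinct[OF assms(2), of k k]
      by (metis order_refl set_stack_sort)
    ultimately show "\<sigma> \<in> preimages (w @ [N])"
      using k(2) by (auto simp: preimages_def stack_sort_split)
  qed
  \<comment> \<open>\<open>N\<close> occurs once in \<open>u @ N # v\<close> and so determines
    \<open>u\<close> and \<open>v\<close>. This gives injectivity of \<open>f\<close> and, through
    \<open>length u\<close>, disjointness over \<open>k\<close>.\<close>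
  have inj: "u = u' \<and> v = v'" if "(u, v) \<in> P k" "(u', v') \<in> P k'" "f (u, v) = f (u', v')"
    for u v u' v' k k'
  proof -
    have "N \<notin> set u" "N \<notin> set v" using set_P[OF that(1)] \<open>N \<notin> set w\<close> by blast+
    then show ?thesis using that(3) append_Cons_eq_iff[of N u v u' v'] by (simp add: f_def)
  qed
  have fin: "finite (P k)" for k by (simp add: P_def)
  have "card (preimages (w @ [N])) = (\<Sum>k\<le>length w. card (f ` P k))"
    unfolding eq
  proof (rule card_UN_disjoint)
    show "\<forall>k\<in>{..length w}. \<forall>k'\<in>{..length w}. k \<noteq> k' \<longrightarrow> f ` P k \<inter> f ` P k' = {}"
    proof (intro ballI impI equals0I)
      fix k k' x assume k: "k \<in> {..length w}" "k' \<in> {..length w}" "k \<noteq> k'" "x \<in> f ` P k \<inter> f ` P k'"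
      then obtain u v u' v' where "(u, v) \<in> P k" "(u', v') \<in> P k'" "f (u, v) = f (u', v')" by auto
      then show False using inj set_P k(1-3) by (metis atMost_iff min_absorb2)
    qed
  qed (simp_all add: fin)
  also have "\<dots> = (\<Sum>k\<le>length w. card (P k))"
  proof (intro sum.cong refl card_image)
    show "inj_on f (P k)" for k using inj[of _ _ k _ _ k] by (auto intro!: inj_onI)
  qed
  finally show ?thesis by (simp add: fert_def P_def card_cartesian_product)
qed

text \<open>The recursion of \<open>fert_snoc\<close> only compares entries. Monotonicity is asked
  on \<open>set w\<close> alone because \<open>fert_map_tail\<close> uses a piecewise map.\<close>

lemma fert_map:
  assumes "strict_mono_on (set w) f" "distinct w"
  shows "fert (map f w) = fert w"
  using assms
proof (induction w rule: length_induct)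
  case (1 w)
  show ?case
  proof (cases w rule: rev_exhaust)
    case (snoc v N)
    have mono: "strict_mono_on (set v) f"
      by (rule monotone_on_subset[OF 1(2)]) (use snoc in auto)
    have IH: "fert (map f (take k v)) = fert (take k v)" "fert (map f (drop k v)) = fert (drop k v)" for k
      using 1 snoc monotone_on_subset[OF mono] by (simp_all add: set_take_subset set_drop_subset)
    have less: "f x < f N \<longleftrightarrow> x < N" if "x \<in> set v" for x
      using strict_mono_on_less[OF 1(2), of x N] that snoc by simp
    show ?thesis
    proof (cases "\<forall>x\<in>set v. x < N")
      case True
      then have "\<forall>x\<in>set (map f v). x < f N" using less by simp
      moreover have "distinct (map f v)"
        using 1(3) snoc strict_mono_on_imp_inj_on[OF mono] by (simp add: distinct_map)
      ultimately show ?thesis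
        using fert_snoc[of v N] fert_snoc[of "map f v" "f N"] True 1(3) snoc
        by (simp add: IH take_map drop_map)
    next
      case False
      then obtain x where "x \<in> set v" "\<not> x < N" by blast
      then show ?thesis
        using fert_eq_0[of x v N] fert_eq_0[of "f x" "map f v" "f N"] snoc less[of x]
        by simp
    qed
  qed simp
qed

text \<open>The cut at the border is counted in the first sum, hence \<open>Suc k\<close> in the
  second.\<close>

lemma sum_splits_append:
  fixes f :: "'a list \<Rightarrow> 'a list \<Rightarrow> 'b :: comm_monoid_add"
  shows "(\<Sum>k\<le>length (x @ y). f (take k (x @ y)) (drop k (x @ y))) =
    (\<Sum>k\<le>length x. f (take k x) (drop k x @ y)) + (\<Sum>k<length y. f (x @ take (Suc k) y) (drop (Suc k) y))"
proof -
  have "(\<Sum>k\<le>length x + q. g k) = (\<Sum>k\<le>length x. g k) + (\<Sum>k<q. g (length x + Suc k))"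
    for g :: "nat \<Rightarrow> 'b" and q
    by (induction q) (auto simp: add.assoc)
  from this[of "\<lambda>k. f (take k (x @ y)) (drop k (x @ y))" "length y"] show ?thesis
    by simp
qed

text \<open>
  In a preimage of \<open>L @ m # R @ T\<close> the entry \<open>m\<close>, read as a node of the decreasing binary tree of
  the preimage, is a left child whose parent is some \<open>T ! j\<close>; the right subtree of that parent
  contributes \<open>R @ take j T\<close>, and removing it together with the parent leaves a preimage of
  \<open>L @ m # drop (Suc j) T\<close>.
\<close>

lemma fert_decomposition:
  assumes "R \<noteq> []" "\<forall>x\<in>set L \<union> set R. x < m" "sorted_wrt (<) T" "\<forall>t\<in>set T. m < t" "distinct (L @ m # R)"
  shows "fert (L @ m # R @ T) =
    (\<Sum>j<length T. fert (R @ take j T) * fert (L @ m # drop (Suc j) T))"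
  using assms
proof (induction T arbitrary: L rule: length_induct)
  case (1 T L)
  note R = 1(2) and LR = 1(3) and T = 1(4,5) and dist = 1(6)
  obtain R' r where r: "R = R' @ [r]" using R by (metis rev_exhaust)
  show ?case
  proof (cases T rule: rev_exhaust)
    case Nil
    \<comment> \<open>Without a tail the word ends with \<open>r\<close>, which is smaller than
      \<open>m\<close>.\<close>
    have "fert ((L @ m # R') @ [r]) = 0" using LR r by (intro fert_eq_0[of m]) auto
    then show ?thesis using Nil r by simp
  next
    case (snoc U t)
    have U: "sorted_wrt (<) U" "\<forall>x\<in>set U. m < x" "\<forall>x\<in>set U. x < t" "m < t" "distinct U"
      using T snoc by (auto simp: sorted_wrt_append strict_sorted_iff)
    have "\<forall>x\<in>set (L @ m # R). x \<le> m" using LR by (simp add: less_imp_le)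
    then have lt: "\<forall>x\<in>set (L @ m # R @ U). x < t" and "\<forall>x\<in>set U. x \<notin> set (L @ m # R)"
      using U(2,3,4) by (auto intro: le_less_trans dest: leD)
    then have disj: "distinct (L @ m # R @ U)" using dist U(5) by auto
    have IH: "fert (L' @ m # R @ V) = (\<Sum>j<length V. fert (R @ take j V) * fert (L' @ m # drop (Suc j) V))"
      if "set L' \<subseteq> set L" "distinct L'" "sorted_wrt (<) V" "set V \<subseteq> set U" "length V \<le> length U" for L' V
    proof -
      have "length V < length T" using that(5) snoc by simp
      moreover have "\<forall>x\<in>set L' \<union> set R. x < m" using LR that(1) by blast
      moreover have "\<forall>x\<in>set V. m < x" using U(2) that(4) by blast
      moreover have "distinct (L' @ m # R)" using dist that(1,2) by auto
      ultimately show ?thesis using 1(1) R that(3) by blast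
    qed
    \<comment> \<open>The root of a preimage is \<open>t\<close>. \<open>S j\<close> is the factor
      for the right subtree of \<open>T ! j\<close>; \<open>A j\<close> collects the cuts of
      \<open>L @ m # drop (Suc j) U\<close> inside \<open>L\<close>, and \<open>C j k\<close> is its
      cut \<open>k\<close> tail entries after \<open>m\<close>.\<close>
    define S where "S j = fert (R @ take j U)" for j
    define A where "A j = (\<Sum>k\<le>length L. fert (take k L) * fert (drop k L @ m # drop (Suc j) U))" for j
    define C where "C j k = fert (L @ m # take k (drop (Suc j) U)) * fert (drop (Suc j + k) U)" for j k
    define q where "q = length U"
    have "fert (L @ m # R @ T) = fert ((L @ m # R @ U) @ [t])" using snoc by simp
    also have "\<dots> = (\<Sum>k\<le>length (L @ m # R @ U). fert (take k (L @ m # R @ U)) * fert (drop k (L @ m # R @ U)))"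
      using lt disj by (intro fert_snoc)
    also have "\<dots> = (\<Sum>k\<le>length L. fert (take k L) * fert (drop k L @ m # R @ U)) +
        (\<Sum>k<Suc (length (R @ U)). fert (L @ m # take k (R @ U)) * fert (drop k (R @ U)))"
      using sum_splits_append[of "\<lambda>u v. fert u * fert v" L "m # R @ U"] by simp
    also have "(\<Sum>k\<le>length L. fert (take k L) * fert (drop k L @ m # R @ U)) = (\<Sum>j<q. S j * A j)"
    proof -
      have "(\<Sum>k\<le>length L. fert (take k L) * fert (drop k L @ m # R @ U)) =
        (\<Sum>k\<le>length L. \<Sum>j<q. S j * (fert (take k L) * fert (drop k L @ m # drop (Suc j) U)))"
        using dist U by (subst IH) (auto simp: sum_distrib_left S_def q_def mult_ac dest: in_set_dropD)
      also have "\<dots> = (\<Sum>j<q. S j * A j)"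
        by (subst sum.swap) (simp add: A_def sum_distrib_left)
      finally show ?thesis .
    qed
    \<comment> \<open>A cut within or at the end of \<open>R\<close> leaves a left part that ends
      below its entry \<open>m\<close>, so of these only the cut right after \<open>m\<close>
      survives. It is the case where \<open>t\<close> is the parent of \<open>m\<close>.\<close>
    also have "(\<Sum>k<Suc (length (R @ U)). fert (L @ m # take k (R @ U)) * fert (drop k (R @ U))) =
      S q * fert (L @ [m]) + (\<Sum>k<q. fert (L @ m # R @ take (Suc k) U) * fert (drop (Suc k) U))"
    proof -
      have "(\<Sum>k<Suc (length (R @ U)). fert (L @ m # take k (R @ U)) * fert (drop k (R @ U))) =
        (\<Sum>k\<le>length R. fert (L @ m # take k R) * fert (drop k R @ U)) +
        (\<Sum>k<q. fert (L @ m # R @ take (Suc k) U) * fert (drop (Suc k) U))"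
        using sum_splits_append[of "\<lambda>u v. fert (L @ m # u) * fert v" R U]
        by (simp only: lessThan_Suc_atMost q_def)
      also have "(\<Sum>k\<le>length R. fert (L @ m # take k R) * fert (drop k R @ U)) =
        (\<Sum>k\<in>{0}. fert (L @ m # take k R) * fert (drop k R @ U))"
      proof (intro sum.mono_neutral_right ballI)
        fix k assume "k \<in> {..length R} - {0}"
        then obtain k' where k: "k = Suc k'" "k' < length R" by (cases k) auto
        then have "L @ m # take k R = (L @ m # take k' R) @ [R ! k']"
          by (simp add: take_Suc_conv_app_nth)
        moreover have "fert ((L @ m # take k' R) @ [R ! k']) = 0"
          using LR k by (intro fert_eq_0[of m]) (auto intro: less_imp_le)
        ultimately show "fert (L @ m # take k R) * fert (drop k R @ U) = 0" by simp
      qed auto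
      finally show ?thesis by (simp add: S_def q_def)
    qed
    also have "(\<Sum>k<q. fert (L @ m # R @ take (Suc k) U) * fert (drop (Suc k) U)) =
      (\<Sum>j<q. S j * (\<Sum>k<q - j. C j k))"
    proof -
      have "fert (L @ m # R @ take (Suc k) U) = (\<Sum>j\<le>k. S j * fert (L @ m # take (k - j) (drop (Suc j) U)))"
        if "k < q" for k
      proof -
        have "fert (L @ m # R @ take (Suc k) U) = (\<Sum>j<Suc k. fert (R @ take j (take (Suc k) U)) *
           fert (L @ m # drop (Suc j) (take (Suc k) U)))"
          using that dist U
          by (subst IH) (auto simp: sorted_wrt_take q_def dest: in_set_takeD intro!: sum.cong)
        then show ?thesis
          by (simp add: lessThan_Suc_atMost S_def min_def drop_take cong: sum.cong_simp)
      qed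
      then have "(\<Sum>k<q. fert (L @ m # R @ take (Suc k) U) * fert (drop (Suc k) U)) =
        (\<Sum>k<q. \<Sum>j\<le>k. S j * C j (k - j))"
        by (simp add: C_def sum_distrib_left mult_ac)
      also have "\<dots> = (\<Sum>(k, j)\<in>(SIGMA k:{..<q}. {..k}). S j * C j (k - j))"
        by (simp add: sum.Sigma)
      \<comment> \<open>The new \<open>k\<close> counts the entries after \<open>U ! j\<close> that
        lie left of the cut.\<close>
      also have "\<dots> = (\<Sum>(j, k)\<in>(SIGMA j:{..<q}. {..<q - j}). S j * C j k)"
        by (rule sum.reindex_bij_witness[where i = "\<lambda>(j, k). (j + k, j)" and j = "\<lambda>(k, j). (j, k - j)"]) auto
      finally show ?thesis by (simp add: sum.Sigma[symmetric] sum_distrib_left)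
    qed
    finally have lhs: "fert (L @ m # R @ T) =
      (\<Sum>j<q. S j * (A j + (\<Sum>k<q - j. C j k))) + S q * fert (L @ [m])"
      by (simp add: sum.distrib distrib_left)
    \<comment> \<open>Cutting the reduced word at its own root \<open>t\<close> produces the same
      terms; \<open>q - j\<close> of its cuts come after \<open>m\<close>.\<close>
    have rhs: "fert (L @ m # drop (Suc j) T) = A j + (\<Sum>k<q - j. C j k)" if "j < q" for j
    proof -
      have "fert (L @ m # drop (Suc j) T) = fert ((L @ m # drop (Suc j) U) @ [t])"
        using snoc that by (simp add: q_def)
      also have "\<dots> = (\<Sum>k\<le>length (L @ m # drop (Suc j) U).
        fert (take k (L @ m # drop (Suc j) U)) * fert (drop k (L @ m # drop (Suc j) U)))"
        using lt disj
        by (intro fert_snoc) (auto dest: in_set_dropD)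
      also have "\<dots> = A j + (\<Sum>k<Suc (q - Suc j). C j k)"
        using sum_splits_append[of "\<lambda>u v. fert u * fert v" L "m # drop (Suc j) U"]
        by (simp add: A_def C_def q_def add.commute del: sum.lessThan_Suc)
      finally show ?thesis using that by (simp add: Suc_diff_Suc del: sum.lessThan_Suc)
    qed
    have "(\<Sum>j<length T. fert (R @ take j T) * fert (L @ m # drop (Suc j) T)) =
      (\<Sum>j<q. fert (R @ take j T) * fert (L @ m # drop (Suc j) T)) + S q * fert (L @ [m])"
      using snoc by (simp add: q_def S_def)
    also have "(\<Sum>j<q. fert (R @ take j T) * fert (L @ m # drop (Suc j) T)) =
      (\<Sum>j<q. S j * (A j + (\<Sum>k<q - j. C j k)))"
    proof (intro sum.cong refl)
      fix j assume "j \<in> {..<q}"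
      then have "take j T = take j U" "j < q" using snoc by (auto simp: q_def)
      then show "fert (R @ take j T) * fert (L @ m # drop (Suc j) T) = S j * (A j + (\<Sum>k<q - j. C j k))"
        by (simp only: rhs S_def)
    qed
    finally show ?thesis using lhs by simp
  qed
qed

section \<open>Catalan numbers\<close>

lemma central_binomial_catalan: "(2 * n choose n) = Suc n * catalan n"
proof -
  have "real (2 * n choose n) = real (Suc n) * real (catalan n)"
    using of_nat_catalan[of n] by (simp add: field_simps)
  then show ?thesis by (simp only: of_nat_eq_iff of_nat_mult[symmetric])
qed

text \<open>Two absorption identities lead from the central binomial \<open>z\<close> through
  \<open>y\<close> to the next one, \<open>x\<close>.\<close>

lemma catalan_Suc: "(n + 2) * catalan (Suc n) = (4 * n + 2) * catalan n"
proof -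
  define x where "x = (2 * Suc n choose Suc n)"
  define y where "y = (Suc (2 * n) choose n)"
  define z where "z = (2 * n choose n)"
  have "2 * Suc n - 1 = Suc (2 * n)" by simp
  then have "Suc n * x = 2 * Suc n * y"
    using binomial_absorption[of n "2 * Suc n"] unfolding x_def y_def by simp
  moreover have "Suc (2 * n) - n = Suc n" "Suc (2 * n) - 1 = 2 * n" by simp_all
  then have "Suc n * y = Suc (2 * n) * z"
    using binomial_absorb_comp[of "Suc (2 * n)" n] unfolding y_def z_def by metis
  ultimately have "(n + 1) * x = (4 * n + 2) * z" by (simp add: algebra_simps)
  then have "Suc n * ((n + 2) * catalan (Suc n)) = Suc n * ((4 * n + 2) * catalan n)"
    unfolding x_def z_def central_binomial_catalan by (simp add: algebra_simps)
  then show ?thesis by (simp only: mult_cancel1) simp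
qed

lemma catalan_0 [simp]: "catalan 0 = 1"
  by (simp add: catalan_def)

text \<open>\<open>T\<close> is the convolution weighted by \<open>k\<close>. Reversing the order
  gives \<open>2 * T n = n * S n\<close>; with \<open>catalan_Suc\<close> this expresses
  \<open>S (Suc n)\<close> by \<open>S n\<close>, and induction applies.\<close>

lemma catalan_convolution: "(\<Sum>k\<le>n. catalan k * catalan (n - k)) = catalan (Suc n)"
proof -
  define S where "S n = (\<Sum>k\<le>n. catalan k * catalan (n - k))" for n
  define T where "T n = (\<Sum>k\<le>n. k * (catalan k * catalan (n - k)))" for n
  have T: "2 * T n = n * S n" for n
  proof -
    have "T n = (\<Sum>k\<le>n. (n - k) * (catalan k * catalan (n - k)))"
      unfolding T_def by (rule sum.reindex_bij_witness[where i = "\<lambda>k. n - k" and j = "\<lambda>k. n - k"]) auto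
    then have "2 * T n = (\<Sum>k\<le>n. k * (catalan k * catalan (n - k)) + (n - k) * (catalan k * catalan (n - k)))"
      unfolding T_def by (simp add: sum.distrib)
    also have "\<dots> = (\<Sum>k\<le>n. n * (catalan k * catalan (n - k)))"
      by (intro sum.cong refl) (auto simp flip: distrib_right)
    finally show ?thesis by (simp add: S_def sum_distrib_left)
  qed
  have "S n = catalan (Suc n)"
  proof (induction n)
    case 0
    then show ?case using catalan_Suc[of 0] by (simp add: S_def)
  next
    case (Suc n)
    \<comment> \<open>Adding \<open>S\<close> raises the weight to \<open>k + 1\<close>, which the
      index shift turns into the factor \<open>k + 2\<close> of \<open>catalan_Suc\<close>.\<close>
    have "T (Suc n) + S (Suc n) = (\<Sum>k\<le>Suc n. (k + 1) * (catalan k * catalan (Suc n - k)))"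
      unfolding T_def S_def by (simp add: sum.distrib distrib_right)
    also have "\<dots> = catalan (Suc n) + (\<Sum>k\<le>n. (k + 2) * catalan (Suc k) * catalan (n - k))"
      by (subst sum.atMost_Suc_shift) (simp add: mult.assoc del: mult_Suc mult_Suc_right)
    also have "(\<Sum>k\<le>n. (k + 2) * catalan (Suc k) * catalan (n - k)) =
      (\<Sum>k\<le>n. (4 * k + 2) * catalan k * catalan (n - k))"
      unfolding catalan_Suc ..
    also have "\<dots> = 4 * T n + 2 * S n"
      unfolding T_def S_def sum_distrib_left sum.distrib[symmetric]
      by (intro sum.cong refl) (simp add: algebra_simps)
    finally have "2 * (T (Suc n) + S (Suc n)) = 2 * catalan (Suc n) + (4 * n + 4) * S n"
      using T[of n] by (simp add: algebra_simps)
    then have "(n + 3) * S (Suc n) = (4 * Suc n + 2) * catalan (Suc n)"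
      using T[of "Suc n"] Suc.IH by (simp add: algebra_simps)
    also have "\<dots> = (n + 3) * catalan (Suc (Suc n))"
      using catalan_Suc[of "Suc n"] by (simp add: algebra_simps)
    finally show ?case by simp
  qed
  then show ?thesis by (simp add: S_def)
qed

text \<open>Both parts of every cut are increasing, so \<open>fert_snoc\<close> becomes the Catalan
  convolution.\<close>

lemma fert_increasing: "sorted_wrt (<) w \<Longrightarrow> fert w = catalan (length w)"
proof (induction w rule: length_induct)
  case (1 w)
  show ?case
  proof (cases w rule: rev_exhaust)
    case (snoc v N)
    have v: "sorted_wrt (<) v" "\<forall>x\<in>set v. x < N" "distinct v"
      using 1(2) snoc by (auto simp: sorted_wrt_append strict_sorted_iff)
    have "fert w = (\<Sum>k\<le>length v. fert (take k v) * fert (drop k v))"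
      using fert_snoc v snoc by simp
    also have "\<dots> = (\<Sum>k\<le>length v. catalan k * catalan (length v - k))"
      using 1(1) snoc v(1) by (intro sum.cong) (auto simp: sorted_wrt_take sorted_wrt_drop)
    finally show ?thesis using catalan_convolution snoc by simp
  qed simp
qed

section \<open>Permutations with an increasing tail\<close>

definition perms :: "nat \<Rightarrow> nat list set" where
  "perms n = permutations_of_set {1..n}"

lemma perm_iff: "w \<in> perms n \<longleftrightarrow> distinct w \<and> set w = {1..n}"
  by (auto simp: perms_def permutations_of_set_def)

lemma finite_perms [simp]: "finite (perms n)"
  by (simp add: perms_def)

lemma sortable_perms_iff: "w \<in> sortable_perms t n \<longleftrightarrow> w \<in> perms n \<and> stack_sortable t w"
  by (simp add: sortable_perms_def perms_def)

lemma perm_length: "w \<in> perms n \<Longrightarrow> length w = n"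
  using distinct_card[of w] by (simp add: perm_iff)

lemma leg_perm:
  assumes "w \<in> perms n"
  shows "leg w = card {a. a \<le> n \<and> splits a (stack_sort w)}"
  using assms leg_eq[of w] perm_length[OF assms] by (simp add: perm_iff)

text \<open>Source of the range of \<open>i\<close> in the recurrence: \<open>a - 1 \<le> i\<close>
  and \<open>b - 1 \<le> n - i\<close>.\<close>

lemma leg_le: "w \<in> perms n \<Longrightarrow> leg w \<le> n + 1"
  unfolding leg_perm by (rule order_trans[OF card_mono[of "{..n}"]]) auto

lemma splits_perm_ends:
  assumes "w \<in> perms n"
  shows "splits 0 (stack_sort w)" "splits n (stack_sort w)"
  using assms splits_trivial(2)[of "stack_sort w" 0] splits_trivial(1)[of "stack_sort w" n]
  by (auto simp: perm_iff)

lemma leg_pos: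
  assumes "w \<in> perms n"
  shows "leg w \<ge> 1"
proof -
  have "card {0 :: nat} \<le> leg w"
    unfolding leg_perm[OF assms] using splits_perm_ends[OF assms] by (intro card_mono) auto
  then show ?thesis by simp
qed

text \<open>The spaces 0 and \<open>n\<close> are always legal; hence the lower bounds 2 on
  \<open>a\<close> and \<open>b\<close> in the recurrence.\<close>

lemma leg_ge_2:
  assumes "w \<in> perms n" "n \<ge> 1"
  shows "leg w \<ge> 2"
proof -
  have "card {0, n} \<le> leg w"
    unfolding leg_perm[OF assms(1)] using splits_perm_ends[OF assms(1)] by (intro card_mono) auto
  then show ?thesis using assms(2) by simp
qed

text \<open>A maximum placed last is output last, which keeps every old legal space and adds only
  \<open>Suc n\<close>.\<close>

lemma perm_snoc:
  assumes "w \<in> perms n"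
  shows "w @ [Suc n] \<in> perms (Suc n)"
    and "leg (w @ [Suc n]) = Suc (leg w)"
    and "stack_sort (w @ [Suc n]) = stack_sort w @ [Suc n]"
    and "avoids_231 (stack_sort (w @ [Suc n])) = avoids_231 (stack_sort w)"
proof -
  have w: "distinct w" "set w = {1..n}" using assms by (auto simp: perm_iff)
  show perm: "w @ [Suc n] \<in> perms (Suc n)" using w by (simp add: perm_iff atLeastAtMostSuc_conv)
  show ss: "stack_sort (w @ [Suc n]) = stack_sort w @ [Suc n]" using w by (intro stack_sort_snoc) auto
  show "avoids_231 (stack_sort (w @ [Suc n])) = avoids_231 (stack_sort w)"
    unfolding ss using w by (intro avoids_231_snoc) auto
  have "{a. a \<le> Suc n \<and> splits a (stack_sort w @ [Suc n])} =
    insert (Suc n) {a. a \<le> n \<and> splits a (stack_sort w)}"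
  proof (intro equalityI subsetI)
    fix a assume "a \<in> {a. a \<le> Suc n \<and> splits a (stack_sort w @ [Suc n])}"
    then show "a \<in> insert (Suc n) {a. a \<le> n \<and> splits a (stack_sort w)}"
      by (auto simp: sorted_wrt_append)
  next
    fix a assume "a \<in> insert (Suc n) {a. a \<le> n \<and> splits a (stack_sort w)}"
    then consider "a = Suc n" | "a \<le> n" "splits a (stack_sort w)" by auto
    then show "a \<in> {a. a \<le> Suc n \<and> splits a (stack_sort w @ [Suc n])}"
    proof cases
      case 1
      then have "splits a (stack_sort w @ [Suc n])" using w by (intro splits_trivial) auto
      then show ?thesis using 1 by simp
    qed (simp add: sorted_wrt_append)
  qed
  then show "leg (w @ [Suc n]) = Suc (leg w)"
    unfolding leg_perm[OF perm] leg_perm[OF assms] ss by simp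
qed

lemma perm_tail:
  assumes "w \<in> perms n"
  shows "w @ [Suc n..<Suc n + l] \<in> perms (n + l) \<and>
    leg (w @ [Suc n..<Suc n + l]) = leg w + l \<and>
    avoids_231 (stack_sort (w @ [Suc n..<Suc n + l])) = avoids_231 (stack_sort w)"
proof (induction l)
  case (Suc l)
  then show ?case using perm_snoc[of "w @ [Suc n..<Suc n + l]" "n + l"]
    by (simp flip: append_assoc)
qed (use assms in simp)

section \<open>Tail length and the numbers \<open>B\<close>\<close>

lemma tail_length_ge_iff:
  assumes "w \<in> perms (n + l)"
  shows "l \<le> tail_length w \<longleftrightarrow> drop n w = [Suc n..<Suc n + l]"
proof -
  have len: "length w = n + l" using perm_length assms by blast
  have "l \<le> tail_length w \<longleftrightarrow> (\<forall>k<l. w ! (n + l - k - 1) = n + l - k)"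
  proof (cases "w = [1..<Suc (length w)]")
    case True
    have "w ! (n + l - k - 1) = n + l - k" if "k < l" for k
      by (subst True) (use len that in \<open>simp del: upt_Suc\<close>)
    then show ?thesis using True len by (simp add: tail_length_def)
  next
    case False
    define P where "P k \<longleftrightarrow> k < length w \<and> w ! (length w - k - 1) \<noteq> length w - k" for k
    have tl: "tail_length w = (LEAST k. P k)"
      using False by (simp add: tail_length_def P_def)
    \<comment> \<open>This makes \<open>LEAST\<close> meaningful: some entry is out of place because
      \<open>w\<close> is not the identity.\<close>
    have "\<exists>k. P k"
    proof (rule ccontr)
      assume *: "\<not> (\<exists>k. P k)"
      have "w ! i = [1..<Suc (length w)] ! i" if "i < length w" for i
      proof -
        have "\<not> P (length w - i - 1)" using * by blast
        then show ?thesis using that by (simp add: P_def del: upt_Suc)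
      qed
      then have "w = [1..<Suc (length w)]" by (intro nth_equalityI) (simp_all del: upt_Suc)
      then show False using False by simp
    qed
    then have "l \<le> tail_length w \<longleftrightarrow> (\<forall>k<l. \<not> P k)"
      unfolding tl by (meson LeastI_ex not_less_Least le_less_trans not_le order.strict_trans2)
    then show ?thesis using len by (simp add: P_def)
  qed
  \<comment> \<open>The two conditions read the last \<open>l\<close> entries in opposite
    directions, with \<open>i = l - k - 1\<close>.\<close>
  also have "\<dots> \<longleftrightarrow> (\<forall>i<l. w ! (n + i) = Suc n + i)"
  proof (intro iffI allI impI)
    fix i assume *: "\<forall>k<l. w ! (n + l - k - 1) = n + l - k" "i < l"
    have "w ! (n + l - (l - i - 1) - 1) = n + l - (l - i - 1)"
      using * by (intro *(1)[rule_format]) auto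
    moreover have "n + l - (l - i - 1) = Suc n + i" using *(2) by simp
    ultimately show "w ! (n + i) = Suc n + i" by simp
  next
    fix k assume *: "\<forall>i<l. w ! (n + i) = Suc n + i" "k < l"
    have "w ! (n + (l - k - 1)) = Suc n + (l - k - 1)" using * by (intro *(1)[rule_format]) auto
    moreover have "n + (l - k - 1) = n + l - k - 1" "Suc n + (l - k - 1) = n + l - k" using *(2) by simp_all
    ultimately show "w ! (n + l - k - 1) = n + l - k" by simp
  qed
  also have "\<dots> \<longleftrightarrow> drop n w = [Suc n..<Suc n + l]"
    using len by (auto simp: list_eq_iff_nth_eq simp del: upt_Suc)
  finally show ?thesis .
qed

text \<open>By \<open>sorted_stack_sort_iff\<close>, the avoidance condition is 2-stack-sortability
  of \<open>w\<close>.\<close>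

definition good_perms :: "nat \<Rightarrow> nat \<Rightarrow> nat list set" where
  "good_perms g n = {w \<in> perms n. avoids_231 (stack_sort w) \<and> leg w = g}"

definition tail_fert :: "nat \<Rightarrow> nat list \<Rightarrow> nat" where
  "tail_fert l w = fert (w @ [Suc (length w)..<Suc (length w) + l])"

lemma finite_good_perms [simp]: "finite (good_perms g n)"
  by (simp add: good_perms_def)

text \<open>The counted \<open>\<sigma>\<close> are grouped by their image, which is
  \<open>w @ T\<close>. By \<open>perm_tail\<close>, appending \<open>T\<close> adds
  \<open>l\<close> legal spaces and does not affect 2-stack-sortability.\<close>

lemma B_eq: "B g l n = (\<Sum>w\<in>good_perms g n. tail_fert l w)"
proof -
  define T where "T = [Suc n..<Suc n + l]"
  have "{\<sigma> \<in> sortable_perms 3 (n + l). tail_length (stack_sort \<sigma>) \<ge> l \<and> leg (stack_sort \<sigma>) = l + g} =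
    (\<Union>w\<in>good_perms g n. preimages (w @ T))" (is "?A = ?B")
  proof (intro equalityI subsetI)
    fix \<sigma> assume "\<sigma> \<in> ?A"
    then have \<sigma>: "distinct \<sigma>" "set \<sigma> = {1..n + l}" "stack_sortable 3 \<sigma>"
      and leg: "tail_length (stack_sort \<sigma>) \<ge> l" "leg (stack_sort \<sigma>) = l + g"
      by (auto simp: sortable_perms_iff perm_iff)
    define w where "w = take n (stack_sort \<sigma>)"
    have p: "stack_sort \<sigma> \<in> perms (n + l)" using \<sigma> by (simp add: perm_iff)
    have w: "stack_sort \<sigma> = w @ T"
      using tail_length_ge_iff[OF p] leg(1) append_take_drop_id[of n "stack_sort \<sigma>"]
      by (simp add: w_def T_def)
    have "distinct (w @ T)" "set (w @ T) = {1..n + l}" using p[unfolded w] unfolding perm_iff by blast+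
    then have "set w \<union> {Suc n..n + l} = {1..n + l}" "set w \<inter> {Suc n..n + l} = {}"
      unfolding T_def by (auto simp: atLeastLessThanSuc_atLeastAtMost)
    then have "set w = {1..n + l} - {Suc n..n + l}" by blast
    also have "\<dots> = {1..n}" by auto
    finally have "w \<in> perms n"
      using \<open>distinct (w @ T)\<close> by (simp add: perm_iff)
    moreover have "avoids_231 (stack_sort (w @ T))" using \<sigma>(1,3) w by (simp add: sortable_3_iff)
    ultimately have "w \<in> good_perms g n"
      using perm_tail[of w n l] leg(2) w by (simp add: good_perms_def T_def del: upt_Suc)
    moreover have "\<sigma> \<in> preimages (w @ T)" using w \<sigma>(1) by (simp add: preimages_def)
    ultimately show "\<sigma> \<in> ?B" by blast
  next
    fix \<sigma> assume "\<sigma> \<in> ?B"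
    then obtain w where w: "w \<in> good_perms g n" "distinct \<sigma>" "stack_sort \<sigma> = w @ T"
      by (auto simp: preimages_def)
    then have wp: "w \<in> perms n" by (simp add: good_perms_def)
    note tail = perm_tail[OF wp, of l, folded T_def]
    have "\<sigma> \<in> perms (n + l)"
      using tail w by (metis perm_iff set_stack_sort)
    moreover have "drop n (w @ T) = T" using perm_length[OF wp] by simp
    then have "tail_length (w @ T) \<ge> l" using tail_length_ge_iff tail T_def by blast
    moreover have "stack_sortable 3 \<sigma>"
      using w tail by (simp add: sortable_3_iff good_perms_def)
    ultimately show "\<sigma> \<in> ?A"
      using w tail by (simp add: sortable_perms_iff good_perms_def)
  qed
  moreover have "card ?B = (\<Sum>w\<in>good_perms g n. card (preimages (w @ T)))"
  proof (rule card_UN_disjoint)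
    show "\<forall>w\<in>good_perms g n. \<forall>w'\<in>good_perms g n. w \<noteq> w' \<longrightarrow> preimages (w @ T) \<inter> preimages (w' @ T) = {}"
      by (auto simp: preimages_def)
  qed simp_all
  moreover have "card (preimages (w @ T)) = tail_fert l w" if "w \<in> good_perms g n" for w
    using that perm_length[of w n] by (simp add: good_perms_def tail_fert_def fert_def T_def)
  ultimately show ?thesis by (simp add: B_def)
qed

lemma W_eq_sum:
  assumes "n \<ge> 1"
  shows "W 3 n = (\<Sum>g=1..n+1. B g 0 n)"
proof -
  have "sortable_perms 3 n = (\<Union>g\<in>{1..n+1}. {\<sigma> \<in> sortable_perms 3 n. leg (stack_sort \<sigma>) = g})"
  proof -
    have "leg (stack_sort \<sigma>) \<in> {1..n+1}" if "\<sigma> \<in> sortable_perms 3 n" for \<sigma>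
    proof -
      have "stack_sort \<sigma> \<in> perms n"
        using that by (simp add: sortable_perms_iff perm_iff)
      then show ?thesis using leg_pos leg_le by auto
    qed
    then show ?thesis by blast
  qed
  moreover have "card \<dots> = (\<Sum>g\<in>{1..n+1}. card {\<sigma> \<in> sortable_perms 3 n. leg (stack_sort \<sigma>) = g})"
    by (rule card_UN_disjoint) (auto simp: sortable_perms_def)
  ultimately show ?thesis by (simp add: W_def B_def)
qed

lemma B_0: "B 0 l n = 0"
proof -
  have "good_perms 0 n = {}" using leg_pos unfolding good_perms_def by fastforce
  then show ?thesis by (simp add: B_eq)
qed

lemma perms_1: "perms 1 = {[1]}"
  by (auto simp: perms_def permutations_of_set_nonempty)

lemma B_1: "B g l 1 = (if g = 2 then catalan (l + 1) else 0)"
proof -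
  have p: "[1] \<in> perms 1" by (simp add: perm_iff)
  have "leg [1] = 2" using leg_ge_2[OF p] leg_le[OF p] by simp
  moreover have "avoids_231 (stack_sort [1])" using stack_sort_snoc[of "[]" 1] by simp
  ultimately have "good_perms g 1 = (if g = 2 then {[1]} else {})"
    unfolding good_perms_def perms_1 by auto
  moreover have "sorted_wrt (<) ([1] @ [Suc 1..<Suc 1 + l])" by (auto simp: sorted_wrt_append)
  from fert_increasing[OF this] have "tail_fert l [1] = catalan (l + 1)"
    by (simp add: tail_fert_def del: upt_Suc)
  ultimately show ?thesis by (simp add: B_eq)
qed

text \<open>Standardizes the factors that \<open>fert_decomposition\<close> produces.\<close>

lemma fert_map_tail:
  assumes "w \<in> perms n" "strict_mono f" "sorted_wrt (<) T" "\<forall>t\<in>set T. f n < t"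
  shows "fert (map f w @ T) = tail_fert (length T) w"
proof -
  have w: "distinct w" "set w = {1..n}" "length w = n" using assms(1) perm_length by (auto simp: perm_iff)
  \<comment> \<open>The order isomorphism from \<open>w\<close> with its standard tail onto
    \<open>map f w @ T\<close>: the tail value \<open>Suc n + r\<close> goes to
    \<open>T ! r\<close>.\<close>
  define f' where "f' y = (if y \<le> n then f y else T ! (y - Suc n))" for y
  define v where "v = w @ [Suc n..<Suc n + length T]"
  have v: "distinct v" "set v = {1..n + length T}"
    using perm_tail[OF assms(1), of "length T"] by (simp_all add: v_def perm_iff)
  have "strict_mono_on (set v) f'"
  proof (rule strict_mono_onI)
    fix x y assume xy: "x \<in> set v" "y \<in> set v" "x < y"
    consider "y \<le> n" | "x \<le> n" "n < y" | "n < x" by linarith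
    then show "f' x < f' y"
    proof cases
      case 1
      then show ?thesis using xy assms(2) by (simp add: f'_def strict_mono_less)
    next
      case 2
      have "f x \<le> f n" using 2 assms(2) by (simp add: strict_mono_less_eq)
      moreover have "f n < T ! (y - Suc n)" using 2 xy v assms(4) by simp
      ultimately show ?thesis using 2 by (simp add: f'_def)
    next
      case 3
      then show ?thesis using xy v assms(3) by (simp add: f'_def sorted_wrt_iff_nth_less)
    qed
  qed
  moreover have "map f' v = map f w @ T"
  proof -
    have "map f' w = map f w" using w by (simp add: f'_def)
    moreover have "map f' [Suc n..<Suc n + length T] = T"
      by (rule nth_equalityI) (simp_all add: f'_def del: upt_Suc)
    ultimately show ?thesis by (simp add: v_def)
  qed
  ultimately show ?thesis using fert_map[of v f'] v(1) unfolding tail_fert_def w(3) v_def by metis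
qed

section \<open>Gluing two permutations around a new maximum\<close>

text \<open>
  For a 2-stack-sortable \<open>L' @ m # R'\<close> with \<open>L'\<close> and \<open>R'\<close> nonempty, \<open>k = length L'\<close> and
  \<open>u\<close> entries of \<open>R'\<close> below \<open>Max (set L')\<close>, the maps \<open>lift_left k u\<close> and
  \<open>lift_right k u\<close> undo the standardization of \<open>L'\<close> and \<open>R'\<close>.
\<close>

definition lift_left :: "nat \<Rightarrow> nat \<Rightarrow> nat \<Rightarrow> nat" where
  "lift_left k u x = (if x < k then x else x + u)"

definition lift_right :: "nat \<Rightarrow> nat \<Rightarrow> nat \<Rightarrow> nat" where
  "lift_right k u y = (if y \<le> u then y + (k - 1) else y + k)"

text \<open>For permutations \<open>L\<close> and \<open>R\<close> with \<open>k = length L\<close>,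
  the entries of \<open>L\<close> below its maximum keep the values below \<open>k\<close>, its
  maximum becomes \<open>k + u\<close>, and \<open>R\<close> takes what remains below the new
  maximum.\<close>

definition glue :: "nat list \<Rightarrow> nat list \<Rightarrow> nat \<Rightarrow> nat list" where
  "glue L R u = map (lift_left (length L) u) L @ Suc (length L + length R) #
     map (lift_right (length L) u) R"

lemma strict_mono_lift_left: "strict_mono (lift_left k u)"
  by (rule strict_monoI) (auto simp: lift_left_def)

lemma strict_mono_lift_right: "strict_mono (lift_right k u)"
  by (rule strict_monoI) (auto simp: lift_right_def)

lemma lift_left_image:
  assumes "k \<ge> 1"
  shows "lift_left k u ` {1..k} = insert (k + u) {1..<k}"
proof -
  have "{1..k} = insert k {1..<k}" using assms by auto
  then show ?thesis by (auto simp: lift_left_def image_iff)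
qed

lemma lift_right_image:
  assumes "k \<ge> 1" "u \<le> i"
  shows "lift_right k u ` {1..i} = {k..k + i} - {k + u}"
proof (intro equalityI subsetI)
  fix x assume x: "x \<in> {k..k + i} - {k + u}"
  define y where "y = (if x < k + u then x - (k - 1) else x - k)"
  have "x = lift_right k u y" "y \<in> {1..i}"
    using x assms by (auto simp: y_def lift_right_def)
  then show "x \<in> lift_right k u ` {1..i}" by blast
qed (use assms in \<open>auto simp: lift_right_def\<close>)

lemma splits_map:
  assumes "\<And>x. x \<in> set w \<Longrightarrow> f x \<le> b \<longleftrightarrow> x \<le> a"
  shows "splits b (map f w) \<longleftrightarrow> splits a w"
  using assms by (induction w) auto

lemma avoids_231_map: "strict_mono f \<Longrightarrow> avoids_231 (map f w) \<longleftrightarrow> avoids_231 w"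
  by (induction w) (simp_all add: splits_map strict_mono_less_eq)

lemma stack_sort_perm_last:
  assumes "w \<in> perms k" "k \<ge> 1"
  shows "\<exists>v. stack_sort w = v @ [k] \<and> set v = {1..<k}"
proof -
  have w: "distinct w" "set w = {1..k}" using assms(1) by (simp_all add: perm_iff)
  then have "w \<noteq> []" using assms(2) by auto
  then obtain L m R where m: "w = L @ m # R" "\<forall>x\<in>set L \<union> set R. x < m"
    using ex_max_split w(1) by blast
  have "m \<in> set w" using m(1) by simp
  moreover have "k \<in> set w" using w(2) assms(2) by simp
  moreover have "\<forall>x\<in>set w. x \<le> m" using m by (simp add: less_imp_le)
  ultimately have "m \<le> k" "k \<le> m" using w(2) by auto
  then have "m = k" by simp
  have "set (stack_sort L @ stack_sort R) = set w - {m}" using m w(1) by auto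
  also have "\<dots> = {1..<k}" unfolding w(2) \<open>m = k\<close> by auto
  finally show ?thesis using stack_sort_split[OF m(2)] m(1) \<open>m = k\<close>
    by (intro exI[of _ "stack_sort L @ stack_sort R"]) simp
qed

section \<open>Sorting, legal spaces and preimages of a glued permutation\<close>

context
  fixes L R :: "nat list" and k i u :: nat
  assumes L: "L \<in> perms k" and R: "R \<in> perms i" and k: "k \<ge> 1" and i: "i \<ge> 1" and u: "u \<le> i"
begin

lemma length_LR: "length L = k" "length R = i"
  using L R perm_length by blast+

lemma glue_sets:
  "set (map (lift_left k u) L) = insert (k + u) {1..<k}"
  "set (map (lift_right k u) R) = {k..k + i} - {k + u}"
  using lift_left_image[OF k, of u] lift_right_image[OF k u] L R by (simp_all add: perm_iff)

lemma glue_less: "\<forall>x\<in>set (map (lift_left k u) L) \<union> set (map (lift_right k u) R). x < Suc (k + i)"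
  unfolding glue_sets using u k by auto

lemma glue_perm: "glue L R u \<in> perms (Suc (k + i))"
proof -
  have "distinct (map (lift_left k u) L)" "distinct (map (lift_right k u) R)"
    using L R strict_mono_imp_inj_on[OF strict_mono_lift_left] strict_mono_imp_inj_on[OF strict_mono_lift_right]
    by (auto simp: perm_iff distinct_map intro: inj_on_subset)
  moreover have "set (map (lift_left k u) L) \<inter> set (map (lift_right k u) R) = {}"
    unfolding glue_sets by auto
  moreover have "Suc (k + i) \<notin> set (map (lift_left k u) L) \<union> set (map (lift_right k u) R)"
    using glue_less by blast
  moreover have "set (glue L R u) = {1..Suc (k + i)}"
    unfolding glue_def length_LR set_append list.set(2) glue_sets using k u by auto
  ultimately show ?thesis by (simp add: glue_def length_LR perm_iff)
qed

lemma stack_sort_glue: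
  "stack_sort (glue L R u) =
    map (lift_left k u) (stack_sort L) @ map (lift_right k u) (stack_sort R) @ [Suc (k + i)]"
  unfolding glue_def length_LR stack_sort_split[OF glue_less]
  using L R by (simp add: stack_sort_map strict_mono_lift_left strict_mono_lift_right perm_iff)

text \<open>For \<open>u \<le> c\<close>, a lifted entry is at most \<open>k + c\<close> iff the
  entry is at most \<open>c\<close>. For \<open>c < u\<close> this is off by one, since entries up
  to \<open>u\<close> are raised by \<open>k - 1\<close> only.\<close>

lemma splits_lift_right:
  "u \<le> c \<Longrightarrow> splits (k + c) (map (lift_right k u) w) \<longleftrightarrow> splits c w"
  by (rule splits_map) (auto simp: lift_right_def)

text \<open>Of the entries from \<open>L\<close>, only the lifted maximum \<open>k + u\<close> can
  exceed entries from \<open>R\<close>. As a 2 it is excluded by \<open>splits u\<close>; since it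
  ends the sorted \<open>L\<close>, no 23 there lies above an entry from \<open>R\<close>.\<close>

lemma avoids_231_glue:
  "avoids_231 (stack_sort (glue L R u)) \<longleftrightarrow>
    avoids_231 (stack_sort L) \<and> avoids_231 (stack_sort R) \<and> splits u (stack_sort R)"
proof -
  define U where "U = map (lift_left k u) (stack_sort L)"
  define V where "V = map (lift_right k u) (stack_sort R)"
  have set_UV: "set U = insert (k + u) {1..<k}" "set V = {k..k + i} - {k + u}"
    using glue_sets by (simp_all add: U_def V_def)
  have "distinct (stack_sort (glue L R u))" using glue_perm by (simp add: perm_iff)
  then have dist: "distinct (U @ V)" by (simp add: stack_sort_glue U_def V_def)
  have "avoids_231 (stack_sort (glue L R u)) \<longleftrightarrow> avoids_231 (U @ V)"
    using avoids_231_snoc[of "U @ V" "Suc (k + i)"] dist glue_less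
    by (simp add: stack_sort_glue U_def V_def)
  also have "\<dots> \<longleftrightarrow> avoids_231 U \<and> avoids_231 V \<and> (\<forall>x\<in>set U. splits x V) \<and>
    (\<forall>z\<in>set V. sorted_wrt (\<lambda>x y. z < x \<longrightarrow> y \<le> x) U)"
    by (rule avoids_231_append[OF dist])
  also have "avoids_231 U \<longleftrightarrow> avoids_231 (stack_sort L)"
    unfolding U_def by (rule avoids_231_map[OF strict_mono_lift_left])
  also have "avoids_231 V \<longleftrightarrow> avoids_231 (stack_sort R)"
    unfolding V_def by (rule avoids_231_map[OF strict_mono_lift_right])
  also have "(\<forall>x\<in>set U. splits x V) \<longleftrightarrow> splits u (stack_sort R)"
  proof -
    have "splits x V" if "x < k" for x
      using that by (intro splits_trivial(2)) (auto simp: set_UV)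
    then have "(\<forall>x\<in>set U. splits x V) \<longleftrightarrow> splits (k + u) V"
      unfolding set_UV by auto
    then show ?thesis by (simp add: V_def splits_lift_right)
  qed
  also have "(\<forall>z\<in>set V. sorted_wrt (\<lambda>x y. z < x \<longrightarrow> y \<le> x) U) \<longleftrightarrow> True"
  proof -
    obtain v where v: "stack_sort L = v @ [k]" "set v = {1..<k}"
      using stack_sort_perm_last[OF L k] by blast
    have "sorted_wrt (\<lambda>x y. z < x \<longrightarrow> y \<le> x) U" if "z \<in> set V" for z
    proof -
      have "\<forall>x\<in>set (map (lift_left k u) v). x < z"
        using that v(2) unfolding set_UV by (auto simp: lift_left_def)
      then have "sorted_wrt (\<lambda>x y. z < x \<longrightarrow> y \<le> x) (map (lift_left k u) v @ [w])" for w
        by (induction v) (auto dest: less_asym)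
      then show ?thesis unfolding U_def v(1) by simp
    qed
    then show ?thesis by blast
  qed
  finally show ?thesis by simp
qed

text \<open>Below \<open>k\<close> only \<open>L\<close> decides. The spaces from \<open>k\<close>
  to \<open>k + u - 1\<close> are illegal because \<open>k + u\<close> from \<open>L\<close>
  precedes \<open>k\<close> from \<open>R\<close> in the output. From \<open>k + u\<close> to
  \<open>k + i\<close> only \<open>R\<close> decides.\<close>

lemma leg_glue: "leg (glue L R u) = leg L + card {c. u \<le> c \<and> c \<le> i \<and> splits c (stack_sort R)}"
proof -
  define U where "U = map (lift_left k u) (stack_sort L)"
  define V where "V = map (lift_right k u) (stack_sort R)"
  define A where "A = {a. a < k \<and> splits a (stack_sort L)}"
  define C where "C = {c. u \<le> c \<and> c \<le> i \<and> splits c (stack_sort R)}"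
  have set_UV: "set U = insert (k + u) {1..<k}" "set V = {k..k + i} - {k + u}"
    using glue_sets by (simp_all add: U_def V_def)
  have ss: "stack_sort (glue L R u) = U @ V @ [Suc (k + i)]"
    by (simp add: stack_sort_glue U_def V_def)
  have append: "splits a (stack_sort (glue L R u)) \<longleftrightarrow>
    splits a U \<and> splits a V \<and> (\<forall>x\<in>set U. \<forall>z\<in>set V. z \<le> a \<longrightarrow> x \<le> a)" if "a \<le> k + i" for a
    using that unfolding ss by (auto simp: sorted_wrt_append)
  have low: "splits a (stack_sort (glue L R u)) \<longleftrightarrow> splits a (stack_sort L)" if "a < k" for a
  proof -
    have "splits a U \<longleftrightarrow> splits a (stack_sort L)"
      unfolding U_def by (rule splits_map) (use that in \<open>auto simp: lift_left_def\<close>)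
    moreover have "splits a V" using that by (intro splits_trivial(2)) (auto simp: set_UV)
    ultimately show ?thesis using that by (subst append) (auto simp: set_UV)
  qed
  have mid: "\<not> splits a (stack_sort (glue L R u))" if "k \<le> a" "a < k + u" for a
  proof -
    have "k + u \<in> set U" "k \<in> set V" "a \<le> k + i" using that u unfolding set_UV by auto
    then show ?thesis using append[of a] that by fastforce
  qed
  have high: "splits (k + c) (stack_sort (glue L R u)) \<longleftrightarrow> splits c (stack_sort R)"
    if "u \<le> c" "c \<le> i" for c
  proof -
    have "\<forall>x\<in>set U. x \<le> k + c" using that unfolding set_UV by auto
    moreover from this have "splits (k + c) U" by (rule splits_trivial)
    moreover have "splits (k + c) V \<longleftrightarrow> splits c (stack_sort R)"
      unfolding V_def by (rule splits_lift_right[OF that(1)])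
    ultimately show ?thesis using that by (subst append) auto
  qed
  have "{a. a \<le> Suc (k + i) \<and> splits a (stack_sort (glue L R u))} =
    insert (Suc (k + i)) (A \<union> (\<lambda>c. k + c) ` C)" (is "?S = ?T")
  proof (intro equalityI subsetI)
    fix a assume "a \<in> ?S"
    then consider "a < k" "splits a (stack_sort (glue L R u))"
      | "k + u \<le> a" "a \<le> k + i" "splits a (stack_sort (glue L R u))" | "a = Suc (k + i)"
      using mid[of a] by fastforce
    then show "a \<in> ?T"
    proof cases
      case 2
      then have "a - k \<in> C" "a = k + (a - k)" using high[of "a - k"] by (auto simp: C_def)
      then show ?thesis by blast
    qed (auto simp: low A_def)
  next
    fix a assume "a \<in> ?T"
    then consider "a = Suc (k + i)" | "a \<in> A" | c where "c \<in> C" "a = k + c" by auto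
    then show "a \<in> ?S"
    proof cases
      case 1
      then show ?thesis using splits_perm_ends(2)[OF glue_perm] by simp
    qed (auto simp: A_def C_def low high)
  qed
  then have "leg (glue L R u) = card ?T" using leg_perm[OF glue_perm] by simp
  also have "\<dots> = Suc (card (A \<union> (\<lambda>c. k + c) ` C))"
    by (rule card_insert_disjoint) (auto simp: A_def C_def)
  also have "card (A \<union> (\<lambda>c. k + c) ` C) = card A + card ((\<lambda>c. k + c) ` C)"
    by (rule card_Un_disjoint) (auto simp: A_def C_def)
  also have "card ((\<lambda>c. k + c) ` C) = card C" by (rule card_image) simp
  \<comment> \<open>The top space \<open>k\<close> of \<open>L\<close> is absent from
    \<open>A\<close>; its place in the count is taken by \<open>Suc (k + i)\<close>.\<close>
  also have "Suc (card A + card C) = leg L + card C"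
  proof -
    have "{a. a \<le> k \<and> splits a (stack_sort L)} = insert k A"
      using splits_perm_ends(2)[OF L] by (auto simp: A_def)
    then show ?thesis unfolding leg_perm[OF L] by (simp add: A_def)
  qed
  finally show ?thesis by (simp add: C_def)
qed

lemma tail_fert_glue: "tail_fert l (glue L R u) = (\<Sum>j<l. tail_fert j R * tail_fert (l - j) L)"
proof -
  define m where "m = Suc (k + i)"
  define L' where "L' = map (lift_left k u) L"
  define R' where "R' = map (lift_right k u) R"
  define T where "T = [Suc m..<Suc m + l]"
  have g: "glue L R u = L' @ m # R'" by (simp add: glue_def length_LR L'_def R'_def m_def)
  have len: "length (glue L R u) = m" using perm_length[OF glue_perm] by (simp add: m_def)
  have "R \<noteq> []" using i length_LR by auto
  have "lift_left k u k < m" "lift_right k u i < m"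
    using u by (auto simp: lift_left_def lift_right_def m_def)
  have lenT: "length T = l" by (simp add: T_def)
  have T: "sorted_wrt (<) T" "\<forall>t\<in>set T. m < t" by (auto simp: T_def simp del: upt_Suc)
  then have less_T: "\<forall>t\<in>set T. lift_right k u i < t" "\<forall>t\<in>set T. lift_left k u k < t"
    using \<open>lift_left k u k < m\<close> \<open>lift_right k u i < m\<close> less_trans by blast+
  have "tail_fert l (glue L R u) = fert (glue L R u @ T)"
    by (simp only: tail_fert_def len T_def)
  also have "\<dots> = fert (L' @ m # R' @ T)"
    by (simp only: g append_assoc append_Cons)
  also have "\<dots> = (\<Sum>j<length T. fert (R' @ take j T) * fert (L' @ m # drop (Suc j) T))"
  proof (rule fert_decomposition)
    show "R' \<noteq> []" using \<open>R \<noteq> []\<close> by (simp add: R'_def)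
    show "\<forall>x\<in>set L' \<union> set R'. x < m" using glue_less unfolding L'_def R'_def m_def .
    show "distinct (L' @ m # R')" using glue_perm g by (simp add: perm_iff)
  qed (use T in auto)
  also have "\<dots> = (\<Sum>j<l. tail_fert j R * tail_fert (l - j) L)"
    unfolding lenT
  proof (intro sum.cong refl)
    fix j assume "j \<in> {..<l}"
    then have j: "j < l" by simp
    have "fert (R' @ take j T) = tail_fert (length (take j T)) R"
      unfolding R'_def using T less_T
      by (intro fert_map_tail[OF R strict_mono_lift_right]) (auto simp: sorted_wrt_take dest: in_set_takeD)
    \<comment> \<open>For \<open>L'\<close> the maximum \<open>m\<close> acts as the first tail
      entry, so this tail has length \<open>l - j\<close>.\<close>
    moreover have "fert (L' @ m # drop (Suc j) T) = tail_fert (length (m # drop (Suc j) T)) L"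
      unfolding L'_def using T less_T \<open>lift_left k u k < m\<close>
      by (intro fert_map_tail[OF L strict_mono_lift_left])
        (auto simp: sorted_wrt_drop dest: in_set_dropD)
    ultimately show "fert (R' @ take j T) * fert (L' @ m # drop (Suc j) T) =
      tail_fert j R * tail_fert (l - j) L"
      using j lenT by (simp add: Suc_diff_Suc)
  qed
  finally show ?thesis .
qed

end

section \<open>Recovering the parts of a glued permutation\<close>

lemma initial_segment:
  assumes "A \<subseteq> {1..n}" "\<forall>x\<in>A. \<forall>y\<in>{1..n} - A. x < y"
  shows "A = {1..card A}"
proof (cases "A = {}")
  case False
  have fin: "finite A" using assms(1) finite_subset by blast
  define M where "M = Max A"
  have M: "M \<in> A" "\<And>x. x \<in> A \<Longrightarrow> x \<le> M" using False fin by (simp_all add: M_def)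
  have "A = {1..M}"
  proof (intro equalityI subsetI)
    fix x assume x: "x \<in> {1..M}"
    have "M \<in> {1..n}" using M(1) assms(1) by blast
    then have "x \<in> {1..n}" using x by simp
    show "x \<in> A"
    proof (rule ccontr)
      assume "x \<notin> A"
      then have "M < x" using assms(2) M(1) \<open>x \<in> {1..n}\<close> by blast
      then show False using x by simp
    qed
  next
    fix x assume "x \<in> A"
    then have "x \<le> M" "x \<in> {1..n}" using M(2) assms(1) by blast+
    then show "x \<in> {1..M}" by simp
  qed
  then show ?thesis by simp
qed simp

lemma ex_map_perm:
  assumes "distinct w" "set w = f ` {1..k}" "inj f"
  shows "\<exists>v\<in>perms k. w = map f v"
proof -
  obtain v where v: "w = map f v" using assms(2) by (metis ex_map_conv imageE)
  then have "f ` set v = f ` {1..k}" using assms(2) by simp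
  then have "set v = {1..k}" using assms(3) inj_image_eq_iff by blast
  then show ?thesis using v assms(1) by (auto simp: perm_iff distinct_map)
qed

lemma ex_glue:
  assumes "L' @ Suc n # R' \<in> perms (Suc n)" "L' \<noteq> []" "R' \<noteq> []"
    and av: "avoids_231 (stack_sort (L' @ Suc n # R'))"
  shows "\<exists>L\<in>perms (length L'). \<exists>R\<in>perms (length R'). \<exists>u\<le>length R'. L' @ Suc n # R' = glue L R u"
proof -
  define k where "k = length L'"
  define i where "i = length R'"
  have ki: "k \<ge> 1" "i \<ge> 1" using assms(2,3) by (simp_all add: k_def i_def Suc_le_eq)
  have dist: "distinct (L' @ Suc n # R')" and sets: "set (L' @ Suc n # R') = {1..Suc n}"
    using assms(1) unfolding perm_iff by blast+
  have n: "n = k + i" using perm_length[OF assms(1)] by (simp add: k_def i_def)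
  have LR: "set L' \<union> set R' = {1..n}"
  proof -
    have "set L' \<union> set R' = set (L' @ Suc n # R') - {Suc n}" using dist by auto
    also have "\<dots> = {1..n}" unfolding sets by auto
    finally show ?thesis .
  qed
  then have less: "\<forall>x\<in>set L' \<union> set R'. x < Suc n" by auto
  obtain L1 M L2 where M: "L' = L1 @ M # L2" "\<forall>x\<in>set L1 \<union> set L2. x < M"
    using ex_max_split[of L'] dist assms(2) by auto
  define A where "A = set L1 \<union> set L2"
  have A: "set L' = insert M A" "M \<notin> A" using M dist by (auto simp: A_def)
  have "card A = k - 1" using distinct_card[of L'] dist A by (simp add: k_def A_def)
  have "avoids_231 ((stack_sort L1 @ stack_sort L2 @ [M]) @ (stack_sort R' @ [Suc n]))"
    using av stack_sort_split[OF less] stack_sort_split[OF M(2)] M(1) by simp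
  moreover have "distinct ((stack_sort L1 @ stack_sort L2 @ [M]) @ (stack_sort R' @ [Suc n]))"
    using dist M(1) by auto
  \<comment> \<open>\<open>M\<close> ends the sorted left part, so an earlier \<open>x\<close> above
    some \<open>z\<close> in \<open>R'\<close> would give the 231-pattern \<open>x\<close>,
    \<open>M\<close>, \<open>z\<close>.\<close>
  ultimately have "\<forall>z\<in>set R'. sorted_wrt (\<lambda>x y. z < x \<longrightarrow> y \<le> x) ((stack_sort L1 @ stack_sort L2) @ [M])"
    by (subst (asm) avoids_231_append) auto
  then have "\<forall>z\<in>set R'. \<forall>x\<in>A. z < x \<longrightarrow> M \<le> x"
    unfolding sorted_wrt_append by (auto simp: A_def)
  then have "\<forall>x\<in>A. \<forall>z\<in>set R'. x \<le> z" using M(2)[folded A_def] by (meson leD not_le)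
  moreover have "set L' \<inter> set R' = {}" using dist by simp
  ultimately have below: "\<forall>x\<in>A. \<forall>z\<in>set R'. x < z" using A by (metis IntI empty_iff insertCI order_le_less)
  have "A = {1..card A}"
  proof (rule initial_segment[of A n])
    show "A \<subseteq> {1..n}" using A(1) LR by blast
    have "{1..n} - A \<subseteq> insert M (set R')" using A(1) LR by blast
    then show "\<forall>x\<in>A. \<forall>y\<in>{1..n} - A. x < y" using below M(2)[folded A_def] by blast
  qed
  then have A_eq: "A = {1..<k}" using \<open>card A = k - 1\<close> ki by (metis Suc_diff_1 atLeastLessThanSuc_atLeastAtMost less_le_trans zero_less_one)
  have "M \<in> {1..n}" "M \<notin> {1..<k}" using A LR A_eq by blast+
  then have Mk: "k \<le> M" "M \<le> k + i" using n ki by auto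
  \<comment> \<open>The values from \<open>k\<close> to \<open>M - 1\<close> all belong to
    \<open>R'\<close>, so \<open>M - k\<close> entries of \<open>R'\<close> lie below
    \<open>M\<close>.\<close>
  define u where "u = M - k"
  have u: "u \<le> i" "M = k + u" using Mk by (auto simp: u_def)
  have "set L' = lift_left k u ` {1..k}" unfolding lift_left_image[OF ki(1)] A A_eq u(2) ..
  then obtain L where L: "L \<in> perms k" "L' = map (lift_left k u) L"
    using ex_map_perm[of L' "lift_left k u" k] dist strict_mono_imp_inj_on[OF strict_mono_lift_left] by auto
  have "set R' = {1..n} - insert M A" using LR \<open>set L' \<inter> set R' = {}\<close> A by blast
  also have "\<dots> = {k..k + i} - {k + u}" unfolding A_eq u(2) n using ki by auto
  finally have "set R' = lift_right k u ` {1..i}" unfolding lift_right_image[OF ki(1) u(1)] .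
  then obtain R where R: "R \<in> perms i" "R' = map (lift_right k u) R"
    using ex_map_perm[of R' "lift_right k u" i] dist strict_mono_imp_inj_on[OF strict_mono_lift_right] by auto
  have "L' @ Suc n # R' = glue L R u"
    unfolding glue_def n using L R perm_length[OF L(1)] perm_length[OF R(1)] by simp
  then show ?thesis using L(1) R(1) u(1) unfolding k_def i_def by blast
qed

text \<open>The position of the maximum gives \<open>k\<close>, the largest value to its left is
  \<open>k + u\<close>, and the lifts are injective.\<close>

lemma glue_inj:
  assumes "glue L R u = glue L' R' u'" "L \<in> perms k" "L' \<in> perms k'" "R \<in> perms i" "R' \<in> perms i'"
    "k \<ge> 1" "k' \<ge> 1" "i \<ge> 1" "i' \<ge> 1" "u \<le> i" "u' \<le> i'"
  shows "L = L' \<and> R = R'"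
proof -
  note p = glue_perm[OF assms(2,4,6,8,10)] glue_perm[OF assms(3,5,7,9,11)]
  note len = length_LR[OF assms(2,4,6,8,10)] length_LR[OF assms(3,5,7,9,11)]
  note sets = glue_sets[OF assms(2,4,6,8,10)] glue_sets[OF assms(3,5,7,9,11)]
  note less = glue_less[OF assms(2,4,6,8,10)]
  have "Suc (k + i) = Suc (k' + i')" using perm_length[OF p(1)] perm_length[OF p(2)] assms(1) by simp
  then have m: "k + i = k' + i'" by simp
  have "map (lift_left k u) L @ Suc (k + i) # map (lift_right k u) R =
    map (lift_left k' u') L' @ Suc (k + i) # map (lift_right k' u') R'"
    using assms(1) m unfolding glue_def len by simp
  moreover have "Suc (k + i) \<notin> set (map (lift_left k u) L)" "Suc (k + i) \<notin> set (map (lift_right k u) R)"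
    using less by blast+
  ultimately have eq: "map (lift_left k u) L = map (lift_left k' u') L'"
    "map (lift_right k u) R = map (lift_right k' u') R'"
    by (simp_all add: append_Cons_eq_iff)
  then have "k = k'" using len by (metis length_map)
  moreover have "u = u'"
  proof -
    have "insert (k + u) {1..<k} = insert (k + u') {1..<k}"
      using sets(1,3) eq(1) \<open>k = k'\<close> by metis
    then have "k + u \<in> insert (k + u') {1..<k}" by blast
    then show ?thesis by simp
  qed
  ultimately show ?thesis
    using eq strict_mono_imp_inj_on[OF strict_mono_lift_left] strict_mono_imp_inj_on[OF strict_mono_lift_right]
    by (metis map_injective inj_mapD)
qed

section \<open>Ranks counted from the top of a finite set\<close>

lemma rank_from_top_less:
  fixes X :: "nat set"
  assumes "finite X" "u \<in> X" "u < v"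
  shows "card {c \<in> X. v \<le> c} < card {c \<in> X. u \<le> c}"
proof (rule psubset_card_mono)
  have "u \<in> {c \<in> X. u \<le> c} - {c \<in> X. v \<le> c}" using assms by simp
  moreover have "{c \<in> X. v \<le> c} \<subseteq> {c \<in> X. u \<le> c}" using assms by auto
  ultimately show "{c \<in> X. v \<le> c} \<subset> {c \<in> X. u \<le> c}" by blast
qed (use assms(1) in simp)

text \<open>The ranks are injective on \<open>X\<close> with values in \<open>{1..card X}\<close>,
  so all occur. By \<open>leg_glue\<close>, the rank of \<open>u\<close> among the legal spaces of
  \<open>R\<close> is what gluing adds to \<open>leg L\<close>.\<close>

lemma ex_rank_from_top:
  fixes X :: "nat set"
  assumes "finite X" "1 \<le> d" "d \<le> card X"
  shows "\<exists>u\<in>X. card {c \<in> X. u \<le> c} = d"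
proof -
  define r where "r u = card {c \<in> X. u \<le> c}" for u
  have less: "r v < r u" if "u \<in> X" "u < v" for u v
    unfolding r_def using assms(1) that by (rule rank_from_top_less)
  have "inj_on r X" by (rule inj_onI) (metis less less_irrefl nat_neq_iff)
  then have "card (r ` X) = card {1..card X}" by (simp add: card_image)
  moreover have "r ` X \<subseteq> {1..card X}"
  proof (intro image_subsetI)
    fix u assume u: "u \<in> X"
    have "card {u} \<le> r u" unfolding r_def using u assms(1) by (intro card_mono) auto
    moreover have "r u \<le> card X" unfolding r_def using assms(1) by (intro card_mono) auto
    ultimately show "r u \<in> {1..card X}" by simp
  qed
  ultimately have "r ` X = {1..card X}" by (intro card_subset_eq) auto
  then have "d \<in> r ` X" using assms(2,3) by simp
  then show ?thesis by (auto simp: r_def)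
qed

section \<open>The recurrence\<close>

text \<open>A maximum placed first yields the same sorted word as one placed last, so
  \<open>perm_snoc\<close> applies.\<close>

lemma perm_Cons:
  assumes "w \<in> perms n"
  shows "Suc n # w \<in> perms (Suc n)"
    and "leg (Suc n # w) = Suc (leg w)"
    and "avoids_231 (stack_sort (Suc n # w)) = avoids_231 (stack_sort w)"
proof -
  have less: "\<forall>x\<in>set w. x < Suc n" using assms by (auto simp: perm_iff)
  show perm: "Suc n # w \<in> perms (Suc n)"
    using assms by (simp add: perm_iff atLeastAtMostSuc_conv)
  have ss: "stack_sort (Suc n # w) = stack_sort (w @ [Suc n])"
    using stack_sort_split[of "[]" w "Suc n"] less perm_snoc(3)[OF assms] by simp
  show "leg (Suc n # w) = Suc (leg w)"
    using leg_perm[OF perm] leg_perm[OF perm_snoc(1)[OF assms]] perm_snoc(2)[OF assms] ss by simp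
  show "avoids_231 (stack_sort (Suc n # w)) = avoids_231 (stack_sort w)"
    unfolding ss by (rule perm_snoc(4)[OF assms])
qed

lemma perm_remove_max:
  assumes "L @ Suc n # R \<in> perms (Suc n)"
  shows "L @ R \<in> perms n"
proof -
  have "distinct (L @ Suc n # R)" "set (L @ Suc n # R) = {1..Suc n}"
    using assms unfolding perm_iff by blast+
  then have "distinct (L @ R)" "set (L @ R) = {1..Suc n} - {Suc n}" by auto
  moreover have "{1..Suc n} - {Suc n} = {1..n}" by auto
  ultimately show ?thesis unfolding perm_iff by simp
qed

lemma tail_fert_snoc:
  assumes "w \<in> perms n"
  shows "tail_fert l (w @ [Suc n]) = tail_fert (Suc l) w"
proof -
  have "[Suc n..<Suc n + Suc l] = Suc n # [Suc (Suc n)..<Suc (Suc n) + l]"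
    by (simp add: upt_conv_Cons del: upt_Suc)
  then show ?thesis using perm_length[OF assms] by (simp add: tail_fert_def del: upt_Suc)
qed

text \<open>The decomposition with empty left part: \<open>m\<close> and the remaining tail form an
  increasing word.\<close>

lemma tail_fert_Cons:
  assumes "w \<in> perms n" "n \<ge> 1"
  shows "tail_fert l (Suc n # w) = (\<Sum>j<l. tail_fert j w * catalan (l - j))"
proof -
  define m where "m = Suc n"
  define T where "T = [Suc m..<Suc m + l]"
  have len: "length w = n" using perm_length[OF assms(1)] .
  have T: "sorted_wrt (<) T" "\<forall>t\<in>set T. m < t" "\<forall>t\<in>set T. n < t" "length T = l"
    by (auto simp: T_def m_def simp del: upt_Suc)
  have "tail_fert l (Suc n # w) = fert ([] @ m # w @ T)"
    by (simp add: tail_fert_def len T_def m_def del: upt_Suc)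
  also have "\<dots> = (\<Sum>j<length T. fert (w @ take j T) * fert ([] @ m # drop (Suc j) T))"
  proof (rule fert_decomposition)
    show "w \<noteq> []" using len assms(2) by auto
    show "\<forall>x\<in>set [] \<union> set w. x < m" using assms(1) by (auto simp: perm_iff m_def)
    show "distinct ([] @ m # w)" using perm_Cons(1)[OF assms(1)] by (simp add: perm_iff m_def)
  qed (use T in auto)
  also have "\<dots> = (\<Sum>j<l. tail_fert j w * catalan (l - j))"
    unfolding T(4)
  proof (intro sum.cong refl)
    fix j assume "j \<in> {..<l}"
    then have j: "j < l" by simp
    \<comment> \<open>The identity map is written out to match \<open>fert_map_tail\<close>.\<close>
    have "fert (map (\<lambda>x. x) w @ take j T) = tail_fert (length (take j T)) w"
      using T by (intro fert_map_tail[OF assms(1)]) (auto simp: sorted_wrt_take strict_mono_def dest: in_set_takeD)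
    moreover have "sorted_wrt (<) (m # drop (Suc j) T)"
      using T by (auto simp: sorted_wrt_drop dest: in_set_dropD)
    then have "fert (m # drop (Suc j) T) = catalan (length (m # drop (Suc j) T))"
      by (rule fert_increasing)
    ultimately show "fert (w @ take j T) * fert ([] @ m # drop (Suc j) T) = tail_fert j w * catalan (l - j)"
      using j T(4) by (simp add: Suc_diff_Suc)
  qed
  finally show ?thesis .
qed

definition legal_set :: "nat list \<Rightarrow> nat set" where
  "legal_set w = {c. c \<le> length w \<and> splits c (stack_sort w)}"

text \<open>The last two bounds say that \<open>g - leg L\<close> is a rank between 1 and
  \<open>leg R\<close>, so some legal space of \<open>R\<close> yields \<open>g\<close> legal spaces
  after gluing.\<close>

definition glue_pairs :: "nat \<Rightarrow> nat \<Rightarrow> (nat list \<times> nat list) set" where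
  "glue_pairs g n = {(L, R). L \<noteq> [] \<and> R \<noteq> [] \<and> length L + length R = n \<and>
     L \<in> good_perms (leg L) (length L) \<and> R \<in> good_perms (leg R) (length R) \<and>
     leg L < g \<and> g \<le> leg L + leg R}"

text \<open>For glue pairs such a \<open>u\<close> exists by \<open>ex_rank_from_top\<close> and is
  unique by \<open>rank_from_top_less\<close>.\<close>

definition glue_pos :: "nat \<Rightarrow> nat list \<Rightarrow> nat list \<Rightarrow> nat" where
  "glue_pos g L R = (SOME u. u \<in> legal_set R \<and> card {c \<in> legal_set R. u \<le> c} = g - leg L)"

lemma finite_legal_set [simp]: "finite (legal_set w)"
  by (simp add: legal_set_def)

lemma card_legal_set: "w \<in> perms n \<Longrightarrow> card (legal_set w) = leg w"
  using leg_perm[of w n] perm_length[of w n] by (simp add: legal_set_def)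

lemma glue_pos:
  assumes "(L, R) \<in> glue_pairs g n"
  shows "glue_pos g L R \<in> legal_set R \<and> card {c \<in> legal_set R. glue_pos g L R \<le> c} = g - leg L"
proof -
  have "R \<in> perms (length R)" "leg L < g" "g \<le> leg L + leg R"
    using assms by (auto simp: glue_pairs_def good_perms_def)
  then have "\<exists>u\<in>legal_set R. card {c \<in> legal_set R. u \<le> c} = g - leg L"
    by (intro ex_rank_from_top) (auto simp: card_legal_set)
  then have "\<exists>u. u \<in> legal_set R \<and> card {c \<in> legal_set R. u \<le> c} = g - leg L" by blast
  from someI_ex[OF this] show ?thesis unfolding glue_pos_def .
qed

lemma finite_glue_pairs: "finite (glue_pairs g n)"
proof (rule finite_subset)
  show "glue_pairs g n \<subseteq> (\<Union>k\<le>n. perms k) \<times> (\<Union>k\<le>n. perms k)"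
  proof (intro subrelI SigmaI)
    fix L R assume "(L, R) \<in> glue_pairs g n"
    then have "L \<in> perms (length L)" "R \<in> perms (length R)" "length L \<le> n" "length R \<le> n"
      by (auto simp: glue_pairs_def good_perms_def)
    then show "L \<in> (\<Union>k\<le>n. perms k)" "R \<in> (\<Union>k\<le>n. perms k)" by blast+
  qed
qed simp

lemma glue_pairs_perms:
  assumes "(L, R) \<in> glue_pairs g n"
  shows "L \<in> perms (length L)" "R \<in> perms (length R)" "length L \<ge> 1" "length R \<ge> 1"
    "glue_pos g L R \<le> length R" "length L + length R = n"
  using assms glue_pos[OF assms]
  by (auto simp: glue_pairs_def good_perms_def legal_set_def Suc_le_eq)

lemma glue_good:
  assumes "L \<in> perms k" "R \<in> perms i" "k \<ge> 1" "i \<ge> 1" "u \<le> i"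
  shows "glue L R u \<in> good_perms g (Suc (k + i)) \<longleftrightarrow>
    avoids_231 (stack_sort L) \<and> avoids_231 (stack_sort R) \<and> u \<in> legal_set R \<and>
    g = leg L + card {c \<in> legal_set R. u \<le> c}"
proof -
  have "{c \<in> legal_set R. u \<le> c} = {c. u \<le> c \<and> c \<le> i \<and> splits c (stack_sort R)}"
    using perm_length[OF assms(2)] by (auto simp: legal_set_def)
  then show ?thesis
    using glue_perm[OF assms] avoids_231_glue[OF assms] leg_glue[OF assms] assms(5) perm_length[OF assms(2)]
    by (auto simp: good_perms_def legal_set_def)
qed

lemma good_perms_Suc:
  assumes "g \<ge> 1"
  shows "good_perms g (Suc n) = (\<lambda>w. w @ [Suc n]) ` good_perms (g - 1) n \<union>
    (\<lambda>w. Suc n # w) ` good_perms (g - 1) n \<union> (\<lambda>(L, R). glue L R (glue_pos g L R)) ` glue_pairs g n"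
    (is "_ = ?A \<union> ?B \<union> ?C")
proof (intro equalityI subsetI)
  fix w assume w: "w \<in> good_perms g (Suc n)"
  then have wp: "w \<in> perms (Suc n)" "avoids_231 (stack_sort w)" "leg w = g" by (auto simp: good_perms_def)
  then have "Suc n \<in> set w" by (simp add: perm_iff)
  then obtain L' R' where LR: "w = L' @ Suc n # R'" by (meson split_list)
  note p = perm_remove_max[OF wp(1)[unfolded LR]]
  consider "R' = []" | "L' = []" | "L' \<noteq> []" "R' \<noteq> []" by blast
  then show "w \<in> ?A \<union> ?B \<union> ?C"
  proof cases
    case 1
    then have "L' \<in> perms n" using p by simp
    then have "L' \<in> good_perms (g - 1) n"
      using perm_snoc[of L' n] wp LR 1 by (auto simp: good_perms_def)
    then show ?thesis using LR 1 by blast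
  next
    case 2
    then have "R' \<in> perms n" using p by simp
    then have "R' \<in> good_perms (g - 1) n"
      using perm_Cons[of R' n] wp LR 2 by (auto simp: good_perms_def)
    then show ?thesis using LR 2 by auto
  next
    case 3
    then obtain L R u where g: "L \<in> perms (length L')" "R \<in> perms (length R')" "u \<le> length R'" "w = glue L R u"
      using ex_glue[of L' n R'] wp LR by blast
    define k where "k = length L'"
    define i where "i = length R'"
    have ki: "k \<ge> 1" "i \<ge> 1" using 3 by (simp_all add: k_def i_def Suc_le_eq)
    have n: "Suc n = Suc (k + i)" using perm_length[OF wp(1)] LR by (simp add: k_def i_def)
    note gg = g[folded k_def i_def]
    have *: "avoids_231 (stack_sort L)" "avoids_231 (stack_sort R)" "u \<in> legal_set R"
      "g = leg L + card {c \<in> legal_set R. u \<le> c}"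
      using glue_good[OF gg(1,2) ki gg(3), of g] w gg(4) n by simp_all
    have "card {c \<in> legal_set R. u \<le> c} \<le> leg R"
      unfolding card_legal_set[OF gg(2), symmetric] by (intro card_mono) auto
    moreover have "card {u} \<le> card {c \<in> legal_set R. u \<le> c}"
      using *(3) by (intro card_mono) auto
    ultimately have pair: "(L, R) \<in> glue_pairs g n"
      using * gg(1,2) ki n perm_length[OF gg(1)] perm_length[OF gg(2)]
      by (auto simp: glue_pairs_def good_perms_def)
    define v where "v = glue_pos g L R"
    have v: "v \<in> legal_set R" "card {c \<in> legal_set R. v \<le> c} = card {c \<in> legal_set R. u \<le> c}"
      using glue_pos[OF pair] *(4) by (simp_all add: v_def)
    \<comment> \<open>Distinct legal spaces have distinct ranks from the top.\<close>
    have "u = v"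
    proof (rule ccontr)
      assume "u \<noteq> v"
      then consider "u < v" | "v < u" by linarith
      then show False
        using rank_from_top_less[of "legal_set R" u v] rank_from_top_less[of "legal_set R" v u] *(3) v
        by cases simp_all
    qed
    then have "w \<in> ?C" using pair gg(4) v_def by force
    then show ?thesis by blast
  qed
next
  fix w assume "w \<in> ?A \<union> ?B \<union> ?C"
  then consider v where "v \<in> good_perms (g - 1) n" "w = v @ [Suc n]"
    | v where "v \<in> good_perms (g - 1) n" "w = Suc n # v"
    | L R where "(L, R) \<in> glue_pairs g n" "w = glue L R (glue_pos g L R)" by auto
  then show "w \<in> good_perms g (Suc n)"
  proof cases
    case (1 v)
    then show ?thesis using perm_snoc[of v n] assms by (simp add: good_perms_def)
  next
    case (2 v)
    then show ?thesis using perm_Cons[of v n] assms by (simp add: good_perms_def)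
  next
    case (3 L R)
    note gp = glue_pairs_perms[OF 3(1)]
    have "leg L < g" "avoids_231 (stack_sort L)" "avoids_231 (stack_sort R)"
      using 3(1) by (simp_all add: glue_pairs_def good_perms_def)
    then have "glue L R (glue_pos g L R) \<in> good_perms g (Suc (length L + length R))"
      using glue_good[OF gp(1-5), of g] glue_pos[OF 3(1)] by simp
    then show ?thesis using 3(2) gp(6) by simp
  qed
qed

text \<open>The position of \<open>Suc n\<close> is last, first or interior, which keeps the three
  images disjoint; for \<open>n = 0\<close> first and last would coincide.\<close>

lemma sum_good_perms_Suc:
  fixes f :: "nat list \<Rightarrow> nat"
  assumes "g \<ge> 1" "n \<ge> 1"
  shows "(\<Sum>w\<in>good_perms g (Suc n). f w) = (\<Sum>w\<in>good_perms (g - 1) n. f (w @ [Suc n])) +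
    (\<Sum>w\<in>good_perms (g - 1) n. f (Suc n # w)) +
    (\<Sum>(L, R)\<in>glue_pairs g n. f (glue L R (glue_pos g L R)))"
proof -
  define A where "A = (\<lambda>w. w @ [Suc n]) ` good_perms (g - 1) n"
  define B where "B = (\<lambda>w. Suc n # w) ` good_perms (g - 1) n"
  define h where "h = (\<lambda>(L, R). glue L R (glue_pos g L R))"
  define C where "C = h ` glue_pairs g n"
  have fin: "finite A" "finite B" "finite C" by (simp_all add: A_def B_def C_def finite_glue_pairs)
  have good: "Suc n \<notin> set w" "w \<noteq> []" if "w \<in> good_perms (g - 1) n" for w
    using that assms(2) perm_length[of w n] by (auto simp: good_perms_def perm_iff)
  have AB: "A \<inter> B = {}"
  proof (intro equals0I)
    fix x assume "x \<in> A \<inter> B"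
    then obtain v w where "v \<in> good_perms (g - 1) n" "v @ [Suc n] = Suc n # w"
      by (auto simp: A_def B_def)
    then show False using good[of v] by (cases v) auto
  qed
  have C: "\<exists>L' R'. x = L' @ Suc n # R' \<and> L' \<noteq> [] \<and> R' \<noteq> [] \<and> Suc n \<notin> set L' \<and> Suc n \<notin> set R'"
    if "x \<in> C" for x
  proof -
    obtain L R where LR: "(L, R) \<in> glue_pairs g n" "x = glue L R (glue_pos g L R)"
      using \<open>x \<in> C\<close> by (auto simp: C_def h_def)
    note gp = glue_pairs_perms[OF LR(1)]
    have "distinct x" using glue_perm[OF gp(1-5)] LR(2) by (simp add: perm_iff)
    then show ?thesis
      using LR(2) gp unfolding glue_def gp(6)
      by (intro exI[of _ "map (lift_left (length L) (glue_pos g L R)) L"]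
          exI[of _ "map (lift_right (length L) (glue_pos g L R)) R"]) auto
  qed
  have AC: "(A \<union> B) \<inter> C = {}"
  proof (intro equals0I)
    fix x assume x: "x \<in> (A \<union> B) \<inter> C"
    then obtain L' R' where LR: "x = L' @ Suc n # R'" "L' \<noteq> []" "R' \<noteq> []" "Suc n \<notin> set L'" "Suc n \<notin> set R'"
      using C by blast
    consider v where "v @ [Suc n] = L' @ Suc n # R'" | v where "[] @ Suc n # v = L' @ Suc n # R'"
      using x LR(1) by (auto simp: A_def B_def)
    then show False
    proof cases
      case (1 v)
      then have "L' = v \<and> R' = []" using LR by (metis append_Cons_eq_iff)
      then show ?thesis using LR by simp
    next
      case (2 v)
      then show ?thesis using LR by (metis append_Cons_eq_iff)
    qed
  qed
  have inj: "inj_on h (glue_pairs g n)"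
  proof (rule inj_onI)
    fix x y assume xy: "x \<in> glue_pairs g n" "y \<in> glue_pairs g n" "h x = h y"
    obtain L R L' R' where eq: "x = (L, R)" "y = (L', R')" by (metis prod.exhaust)
    show "x = y"
      using glue_inj[OF _ glue_pairs_perms(1)[of L R g n] glue_pairs_perms(1)[of L' R' g n]
          glue_pairs_perms(2)[of L R g n] glue_pairs_perms(2)[of L' R' g n]
          glue_pairs_perms(3)[of L R g n] glue_pairs_perms(3)[of L' R' g n]
          glue_pairs_perms(4)[of L R g n] glue_pairs_perms(4)[of L' R' g n]
          glue_pairs_perms(5)[of L R g n] glue_pairs_perms(5)[of L' R' g n]] xy
      unfolding eq h_def by simp
  qed
  have "sum f (good_perms g (Suc n)) = sum f A + sum f B + sum f C"
    unfolding good_perms_Suc[OF assms(1)] A_def[symmetric] B_def[symmetric] h_def[symmetric] C_def[symmetric]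
    using fin AB AC by (simp add: sum.union_disjoint)
  also have "sum f A = (\<Sum>w\<in>good_perms (g - 1) n. f (w @ [Suc n]))"
    unfolding A_def by (subst sum.reindex) (auto intro: inj_onI)
  also have "sum f B = (\<Sum>w\<in>good_perms (g - 1) n. f (Suc n # w))"
    unfolding B_def by (subst sum.reindex) (auto intro: inj_onI)
  also have "sum f C = (\<Sum>(L, R)\<in>glue_pairs g n. f (glue L R (glue_pos g L R)))"
    unfolding C_def sum.reindex[OF inj] by (rule sum.cong) (auto simp: h_def)
  finally show ?thesis .
qed

text \<open>Pairs are grouped by \<open>a = leg R\<close>, \<open>b = leg L\<close> and
  \<open>i = length R\<close>. The bounds on legal spaces in \<open>glue_pairs\<close>,
  \<open>leg_ge_2\<close> and \<open>leg_le\<close> give the ranges.\<close>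

lemma sum_glue_pairs:
  fixes p q :: "nat list \<Rightarrow> nat"
  assumes "n \<ge> 1" "g \<ge> 1"
  shows "(\<Sum>(L, R)\<in>glue_pairs g n. p R * q L) =
    (\<Sum>a=2..n. \<Sum>b=max 2 (g - a)..g - 1. \<Sum>i=a - 1..n + 1 - b.
       (\<Sum>R\<in>good_perms a i. p R) * (\<Sum>L\<in>good_perms b (n - i). q L))"
proof -
  define P where "P = (SIGMA a:{2..n}. SIGMA b:{max 2 (g - a)..g - 1}. {a - 1..n + 1 - b})"
  define key where "key = (\<lambda>(L, R). (leg R, leg L, length R))"
  have finP: "finite P" by (simp add: P_def)
  have "key ` glue_pairs g n \<subseteq> P"
  proof (intro image_subsetI)
    fix x assume x: "x \<in> glue_pairs g n"
    obtain L R where LR: "x = (L, R)" by force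
    note gp = glue_pairs_perms[OF x[unfolded LR]]
    have "leg L < g" "g \<le> leg L + leg R" using x LR by (simp_all add: glue_pairs_def)
    moreover note leg_ge_2[OF gp(1,3)] leg_ge_2[OF gp(2,4)] leg_le[OF gp(1)] leg_le[OF gp(2)] gp(3,4,6)
    ultimately show "key x \<in> P" unfolding key_def P_def LR by auto
  qed
  then have "(\<Sum>x\<in>glue_pairs g n. (\<lambda>(L, R). p R * q L) x) =
    (\<Sum>y\<in>P. \<Sum>x\<in>{x \<in> glue_pairs g n. key x = y}. (\<lambda>(L, R). p R * q L) x)"
    by (rule sum.group[OF finite_glue_pairs finP, symmetric])
  also have "\<dots> = (\<Sum>(a, b, i)\<in>P. (\<Sum>R\<in>good_perms a i. p R) * (\<Sum>L\<in>good_perms b (n - i). q L))"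
  proof (intro sum.cong refl)
    fix y assume y: "y \<in> P"
    obtain a b i where abi: "y = (a, b, i)" by (metis prod.exhaust)
    have r: "2 \<le> a" "a \<le> n" "2 \<le> b" "g - a \<le> b" "b \<le> g - 1" "a - 1 \<le> i" "i \<le> n + 1 - b"
      using y unfolding P_def abi by auto
    \<comment> \<open>Since \<open>1 \<le> a - 1 \<le> i\<close>, the truncated bound
      \<open>n + 1 - b\<close> is positive; so \<open>b \<le> n\<close>, and neither part is
      empty.\<close>
    then have r': "i \<ge> 1" "n - i \<ge> 1" "n - i + i = n" "b < g" "g \<le> b + a" using assms by auto
    have "{x \<in> glue_pairs g n. key x = y} = good_perms b (n - i) \<times> good_perms a i"
    proof (intro equalityI subsetI)
      fix x assume x: "x \<in> {x \<in> glue_pairs g n. key x = y}"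
      then show "x \<in> good_perms b (n - i) \<times> good_perms a i"
        by (auto simp: glue_pairs_def key_def abi)
    next
      fix x assume "x \<in> good_perms b (n - i) \<times> good_perms a i"
      then obtain L R where x: "x = (L, R)" "L \<in> good_perms b (n - i)" "R \<in> good_perms a i" by auto
      have len: "length L = n - i" "length R = i"
        using x perm_length by (auto simp: good_perms_def)
      have leg: "leg L = b" "leg R = a" using x by (auto simp: good_perms_def)
      have "L \<noteq> []" "R \<noteq> []" using len r' by auto
      then show "x \<in> {x \<in> glue_pairs g n. key x = y}"
        using x len leg r' by (simp add: glue_pairs_def key_def abi)
    qed
    then show "(\<Sum>x\<in>{x \<in> glue_pairs g n. key x = y}. (\<lambda>(L, R). p R * q L) x) =
      (case y of (a, b, i) \<Rightarrow> (\<Sum>R\<in>good_perms a i. p R) * (\<Sum>L\<in>good_perms b (n - i). q L))"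
      unfolding abi by (simp add: sum_product sum.cartesian_product[symmetric] sum.swap[of _ "good_perms b (n - i)"])
  qed
  finally show ?thesis by (simp add: P_def sum.Sigma split_def)
qed

text \<open>The bound is written \<open>n + 1 - b\<close> because the range must be empty for
  \<open>b > n\<close>, where \<open>n - b + 1\<close> truncates to 1.\<close>

lemma B_Suc:
  assumes "n \<ge> 1" "g \<ge> 1"
  shows "B g l (n + 1) =
    (\<Sum>j=1..l. (\<Sum>a=2..n. \<Sum>b=max 2 (g - a)..g - 1. \<Sum>i=a - 1..n + 1 - b.
        B a (j - 1) i * B b (l + 1 - j) (n - i))
      + B (g - 1) (j - 1) n * catalan (l - j + 1))
    + B (g - 1) (l + 1) n"
proof -
  have "B g l (n + 1) = (\<Sum>w\<in>good_perms (g - 1) n. tail_fert l (w @ [Suc n])) +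
    (\<Sum>w\<in>good_perms (g - 1) n. tail_fert l (Suc n # w)) +
    (\<Sum>(L, R)\<in>glue_pairs g n. tail_fert l (glue L R (glue_pos g L R)))"
    unfolding B_eq Suc_eq_plus1[symmetric] by (rule sum_good_perms_Suc[OF assms(2,1)])
  also have "(\<Sum>w\<in>good_perms (g - 1) n. tail_fert l (w @ [Suc n])) = B (g - 1) (l + 1) n"
    unfolding B_eq by (intro sum.cong refl) (simp add: good_perms_def tail_fert_snoc)
  also have "(\<Sum>w\<in>good_perms (g - 1) n. tail_fert l (Suc n # w)) =
    (\<Sum>w\<in>good_perms (g - 1) n. \<Sum>j<l. tail_fert j w * catalan (l - j))"
    using assms(1) by (intro sum.cong refl) (simp add: good_perms_def tail_fert_Cons)
  also have "\<dots> = (\<Sum>j<l. B (g - 1) j n * catalan (l - j))"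
    by (subst sum.swap) (simp add: B_eq sum_distrib_right)
  also have "(\<Sum>(L, R)\<in>glue_pairs g n. tail_fert l (glue L R (glue_pos g L R))) =
    (\<Sum>(L, R)\<in>glue_pairs g n. \<Sum>j<l. tail_fert j R * tail_fert (l - j) L)"
  proof (intro sum.cong refl)
    fix x assume "x \<in> glue_pairs g n"
    then show "(case x of (L, R) \<Rightarrow> tail_fert l (glue L R (glue_pos g L R))) =
      (case x of (L, R) \<Rightarrow> \<Sum>j<l. tail_fert j R * tail_fert (l - j) L)"
      using tail_fert_glue[OF glue_pairs_perms(1-5)] by (cases x) auto
  qed
  also have "\<dots> = (\<Sum>j<l. \<Sum>(L, R)\<in>glue_pairs g n. tail_fert j R * tail_fert (l - j) L)"
    unfolding split_def by (rule sum.swap)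
  also have "\<dots> = (\<Sum>j<l. \<Sum>a=2..n. \<Sum>b=max 2 (g - a)..g - 1. \<Sum>i=a - 1..n + 1 - b.
        B a j i * B b (l - j) (n - i))"
    unfolding sum_glue_pairs[OF assms] B_eq ..
  finally have *: "B g l (n + 1) =
    (\<Sum>j<l. (\<Sum>a=2..n. \<Sum>b=max 2 (g - a)..g - 1. \<Sum>i=a - 1..n + 1 - b. B a j i * B b (l - j) (n - i)) +
      B (g - 1) j n * catalan (l - j)) + B (g - 1) (l + 1) n"
    by (simp add: sum.distrib)
  \<comment> \<open>\<open>fert_decomposition\<close> numbers the tail entries from 0, the
    recurrence from 1.\<close>
  have "(\<Sum>j=1..l. F (j - 1) (l + 1 - j) (l - j + 1)) = (\<Sum>j<l. F j (l - j) (l - j))"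
    for F :: "nat \<Rightarrow> nat \<Rightarrow> nat \<Rightarrow> nat"
    by (rule sum.reindex_bij_witness[where i = Suc and j = "\<lambda>j. j - 1"]) (auto simp: Suc_diff_Suc Suc_diff_le)
  from this[of "\<lambda>j x y. (\<Sum>a=2..n. \<Sum>b=max 2 (g - a)..g - 1. \<Sum>i=a - 1..n + 1 - b.
      B a j i * B b x (n - i)) + B (g - 1) j n * catalan y"]
  show ?thesis unfolding * by simp
qed

theorem theorem6:
  shows "(\<forall>n\<ge>1. W 3 n = (\<Sum>g=1..n+1. B g 0 n)) \<and>
    (\<forall>l n. n \<ge> 1 \<longrightarrow> B 0 l n = 0) \<and>
    (\<forall>g l. B g l 1 = (if g = 2 then catalan (l + 1) else 0)) \<and>
    (\<forall>n g l. n \<ge> 1 \<and> g \<ge> 1 \<longrightarrow>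
       B g l (n + 1) =
         (\<Sum>j=1..l.
            (\<Sum>a=2..n. \<Sum>b=max 2 (g - a)..g - 1. \<Sum>i=a - 1..n + 1 - b.
               B a (j - 1) i * B b (l + 1 - j) (n - i))
            + B (g - 1) (j - 1) n * catalan (l - j + 1))
         + B (g - 1) (l + 1) n)"
  using W_eq_sum B_0 B_1 B_Suc by blast

end
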